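(* Let $p$ be a natural number. If $\Omega\subset\mathbb{C}$ is a smooth bounded simply connected one-point quadrature domain for the weighted area measure $|z|^{2p}dA$, with $0\in\Omega$, whose quadrature node is not the origin, then $\Omega$ is the conformal image of the unit disc $\mathbb{D}$ under a map of the form $$\varphi(t)=\frac{Ct}{(1-t\overline{\zeta}_0)^{1/(p+1)}},$$ where $C$ is a constant, $\zeta_0\in\mathbb{D}$ with $\zeta_0\neq0$, and the root denotes an analytic branch on $\mathbb{D}$.
   Context: Natural numbers are $1,2,3,\dots$; $dA$ is Lebesgue area measure; a smooth bounded domain is a bounded connected open set with $\mathcal{C}^\infty$ smooth boundary. $\mathcal{A}^\infty(\Omega)$ is the space of analytic functions on $\Omega$ that are $\mathcal{C}^\infty$ smooth up to the boundary. $\Omega$ is a one-point quadrature domain with respect to $|z|^{2p}dA$ with quadrature node $z_0\in\Omega$ if there is a constant $c\in\mathbb{C}$ such that $\int_\Omega f(z)|z|^{2p}dA=c\,f(z_0)$ for all $f\in\mathcal{A}^\infty(\Omega)$. *)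

theory Defs
  imports "HOL-Complex_Analysis.Complex_Analysis"
begin

text \<open>Iterated partial derivatives, indexed by the list of differentiation directions; the head
  of the list is the outermost differentiation.\<close>

fun iter_partial :: "'a::euclidean_space list \<Rightarrow> ('a \<Rightarrow> 'b::real_normed_vector) \<Rightarrow> 'a \<Rightarrow> 'b" where
  "iter_partial [] f = f"
| "iter_partial (v # vs) f = (\<lambda>x. frechet_derivative (iter_partial vs f) (at x) v)"

definition smooth_on :: "'a::euclidean_space set \<Rightarrow> ('a \<Rightarrow> 'b::real_normed_vector) \<Rightarrow> bool" where
  "smooth_on U f \<longleftrightarrow>
     open U \<and> (\<forall>vs. set vs \<subseteq> Basis \<longrightarrow> (\<forall>x\<in>U. iter_partial vs f differentiable (at x)))"

text \<open>Only the values of \<open>f\<close> on the open set \<open>U\<close> matter.\<close>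

definition smooth_up_to_boundary ::
    "'a::euclidean_space set \<Rightarrow> ('a \<Rightarrow> 'b::real_normed_vector) \<Rightarrow> bool" where
  "smooth_up_to_boundary U f \<longleftrightarrow>
     smooth_on U f \<and>
     (\<forall>vs. set vs \<subseteq> Basis \<longrightarrow>
        (\<exists>g. continuous_on (closure U) g \<and> (\<forall>x\<in>U. g x = iter_partial vs f x)))"

definition A_infinity :: "complex set \<Rightarrow> (complex \<Rightarrow> complex) set" where
  "A_infinity \<Omega> = {f. f holomorphic_on \<Omega> \<and> smooth_up_to_boundary \<Omega> f}"

text \<open>The boundary is given near each of its points by a smooth defining function with
  nonvanishing differential; in particular \<open>\<Omega>\<close> lies locally on one side of its boundary.\<close>

definition smooth_boundary :: "complex set \<Rightarrow> bool" where
  "smooth_boundary \<Omega> \<longleftrightarrow>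
     (\<forall>w\<in>frontier \<Omega>. \<exists>U (r :: complex \<Rightarrow> real).
        open U \<and> w \<in> U \<and> smooth_on U r \<and>
        (\<forall>z\<in>U. frechet_derivative r (at z) \<noteq> (\<lambda>_. 0)) \<and>
        \<Omega> \<inter> U = {z\<in>U. r z < 0})"

definition smooth_bounded_domain :: "complex set \<Rightarrow> bool" where
  "smooth_bounded_domain \<Omega> \<longleftrightarrow>
     \<Omega> \<noteq> {} \<and> open \<Omega> \<and> connected \<Omega> \<and> bounded \<Omega> \<and> smooth_boundary \<Omega>"

definition one_point_quadrature_domain :: "nat \<Rightarrow> complex set \<Rightarrow> complex \<Rightarrow> bool" where
  "one_point_quadrature_domain p \<Omega> z\<^sub>0 \<longleftrightarrow>
     z\<^sub>0 \<in> \<Omega> \<and>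
     (\<exists>c::complex. \<forall>f\<in>A_infinity \<Omega>.
        (LINT z:\<Omega>|lborel. f z * of_real (cmod z ^ (2 * p))) = c * f z\<^sub>0)"

text \<open>The inverse of a holomorphic bijection between open sets is automatically holomorphic.\<close>

definition conformal_map_onto :: "(complex \<Rightarrow> complex) \<Rightarrow> complex set \<Rightarrow> complex set \<Rightarrow> bool" where
  "conformal_map_onto \<phi> S T \<longleftrightarrow> \<phi> holomorphic_on S \<and> bij_betw \<phi> S T"

definition analytic_root_branch ::
    "nat \<Rightarrow> (complex \<Rightarrow> complex) \<Rightarrow> (complex \<Rightarrow> complex) \<Rightarrow> complex set \<Rightarrow> bool" where
  "analytic_root_branch n g h S \<longleftrightarrow> h holomorphic_on S \<and> (\<forall>t\<in>S. h t ^ n = g t)"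

end

theory Submission
  imports Defs
begin

text \<open>Testing the quadrature identity on the kernels \<open>z \<mapsto> 1 / (w - z)\<close> with \<open>w\<close> outside \<open>closure \<Omega>\<close>
  shows that the Cauchy transform of the density \<open>\<bar>z\<bar> ^ (2 * p)\<close> on \<open>\<Omega>\<close> equals \<open>c / (w - z\<^sub>0)\<close> there. By
  rotation invariance, the transform of the same density on a large disc is \<open>K * w ^ p * cnj w ^ (p + 1)\<close>,
  and the transform \<open>v\<close> of the density on the disc minus \<open>\<Omega>\<close> is continuous everywhere and holomorphic in
  \<open>\<Omega>\<close>. Hence \<open>K * w ^ p * cnj w ^ (p + 1) = v w + c / (w - z\<^sub>0)\<close> on \<open>frontier \<Omega>\<close>. Pull this back by the
  Riemann map \<open>\<phi>\<close> with \<open>\<phi> 0 = 0\<close> and \<open>\<phi> \<zeta>\<^sub>0 = z\<^sub>0\<close>, and write \<open>\<phi> t = t * q t\<close>. As \<open>norm t\<close> tends to \<open>1\<close>, the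
  conjugate of the holomorphic function \<open>(1 - cnj \<zeta>\<^sub>0 * t) * q t ^ (p + 1)\<close> approaches a holomorphic
  function on the disc, so it is constant by the maximum principle. No boundary regularity of \<open>\<phi>\<close> is
  used: \<open>\<phi>\<close> is proper, so boundary values are only ever approached uniformly.\<close>

subsection \<open>Rotation invariance and the planar kernel\<close>

lemma nn_integral_lborel_translate:
  fixes f :: "'a::euclidean_space \<Rightarrow> ennreal"
  assumes [measurable]: "f \<in> borel_measurable borel"
  shows "(\<integral>\<^sup>+x. f (c + x) \<partial>lborel) = (\<integral>\<^sup>+x. f x \<partial>lborel)"
proof -
  have "(\<integral>\<^sup>+x. f x \<partial>distr lborel borel ((+) c)) = (\<integral>\<^sup>+x. f (c + x) \<partial>lborel)"
    by (subst nn_integral_distr) auto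
  then show ?thesis by (simp add: lborel_distr_plus)
qed

lemma distr_lborel_orthogonal_transformation:
  fixes T :: "'a::euclidean_space \<Rightarrow> 'a"
  assumes T: "orthogonal_transformation T"
  shows "distr lborel borel T = lborel"
proof (rule measure_eqI)
  fix A assume "A \<in> sets (distr lborel borel T)"
  then have A[measurable]: "A \<in> sets borel" by simp
  define S where "S = inv T"
  have TS: "T (S x) = x" for x
    unfolding S_def using orthogonal_transformation_surj[OF T] by (simp add: surj_f_inv_f)
  have lin: "linear T" by (rule orthogonal_transformation_linear[OF T])
  have [measurable]: "T \<in> borel_measurable borel"
    using lin by (intro borel_measurable_continuous_onI linear_continuous_on)
      (simp add: linear_conv_bounded_linear)
  have linS: "linear S" unfolding S_def
    by (rule orthogonal_transformation_linear[OF orthogonal_transformation_inv[OF T]])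
  have [measurable]: "S \<in> borel_measurable borel"
    using linS by (intro borel_measurable_continuous_onI linear_continuous_on)
      (simp add: linear_conv_bounded_linear)
  define B where "B = ball (0::'a) 1"
  have [measurable]: "B \<in> sets borel" by (simp add: B_def)
  have "emeasure lborel (T -` A) * emeasure lborel B
      = (\<integral>\<^sup>+y. (\<integral>\<^sup>+x. indicator A (T x) * indicator B y \<partial>lborel) \<partial>lborel)"
  proof -
    have "(\<integral>\<^sup>+x. indicator A (T x) \<partial>lborel) = emeasure lborel (T -` A)"
      using nn_integral_indicator[of "T -` A" lborel] measurable_sets[of T borel borel A]
      by (simp add: indicator_def vimage_def)
    then show ?thesis
      by (simp add: nn_integral_multc nn_integral_cmult)
  qed
  also have "\<dots> = (\<integral>\<^sup>+y. (\<integral>\<^sup>+x. indicator A (y + T x) * indicator B y \<partial>lborel) \<partial>lborel)"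
  proof (rule nn_integral_cong)
    fix y
    show "(\<integral>\<^sup>+x. indicator A (T x) * indicator B y \<partial>lborel)
        = (\<integral>\<^sup>+x. indicator A (y + T x) * indicator B y \<partial>lborel)"
      using nn_integral_lborel_translate[of "\<lambda>x. indicator A (T x) * indicator B y" "S y"]
      by (simp add: linear_add[OF lin] TS)
  qed
  also have "\<dots> = (\<integral>\<^sup>+x. (\<integral>\<^sup>+y. indicator A (y + T x) * indicator B y \<partial>lborel) \<partial>lborel)"
    by (rule lborel_pair.Fubini') simp
  also have "\<dots> = (\<integral>\<^sup>+x. (\<integral>\<^sup>+y. indicator A y * indicator B (y - T x) \<partial>lborel) \<partial>lborel)"
  proof (rule nn_integral_cong)
    fix x
    show "(\<integral>\<^sup>+y. indicator A (y + T x) * indicator B y \<partial>lborel)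
        = (\<integral>\<^sup>+y. indicator A y * indicator B (y - T x) \<partial>lborel)"
      using nn_integral_lborel_translate[of "\<lambda>y. indicator A (y + T x) * indicator B y" "- T x"]
      by (simp add: algebra_simps)
  qed
  also have "\<dots> = (\<integral>\<^sup>+y. (\<integral>\<^sup>+x. indicator A y * indicator B (y - T x) \<partial>lborel) \<partial>lborel)"
    by (rule lborel_pair.Fubini') simp
  also have "\<dots> = (\<integral>\<^sup>+y. indicator A y * emeasure lborel B \<partial>lborel)"
  proof (rule nn_integral_cong)
    fix y
    have "indicator B (y - T x) = (indicator (ball (S y) 1) x :: ennreal)" for x
    proof -
      have "y - T x = T (S y - x)" by (simp add: linear_diff[OF lin] TS)
      then show ?thesis
        by (simp add: B_def indicator_def dist_norm orthogonal_transformation_norm[OF T])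
    qed
    then have "(\<integral>\<^sup>+x. indicator B (y - T x) \<partial>lborel) = emeasure lborel (ball (S y) 1)"
      by simp
    also have "\<dots> = emeasure lborel B" by (simp add: B_def emeasure_ball)
    finally show "(\<integral>\<^sup>+x. indicator A y * indicator B (y - T x) \<partial>lborel)
        = indicator A y * emeasure lborel B"
      by (simp add: nn_integral_cmult)
  qed
  also have "\<dots> = emeasure lborel A * emeasure lborel B"
    by (simp add: nn_integral_multc)
  finally have "emeasure lborel (T -` A) * emeasure lborel B = emeasure lborel A * emeasure lborel B" .
  moreover have "unit_ball_vol (real DIM('a)) \<noteq> 0"
    by (metis less_irrefl of_nat_0_le_iff unit_ball_vol_pos)
  then have "emeasure lborel B \<noteq> 0" "emeasure lborel B \<noteq> \<infinity>"
    by (auto simp: B_def emeasure_ball)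
  ultimately have "emeasure lborel (T -` A) = emeasure lborel A"
    by (simp add: ennreal_mult_cancel_left mult.commute[of _ "emeasure lborel B"])
  then show "emeasure (distr lborel borel T) A = emeasure lborel A"
    by (simp add: emeasure_distr)
qed simp

text \<open>On a dyadic annulus \<open>r / 2 ^ Suc n \<le> norm (a - z) < r / 2 ^ n\<close> the kernel is at most
  \<open>2 ^ Suc n / r\<close>.\<close>
lemma nn_integral_inverse_dist_ball:
  fixes a :: complex
  assumes r: "r > 0"
  shows "(\<integral>\<^sup>+z. ennreal (indicator (ball a r) z / norm (a - z)) \<partial>lborel) \<le> ennreal (4 * pi * r)"
proof -
  have 1: "ennreal (indicator (ball a r) z / norm (a - z))
      \<le> (\<Sum>n. ennreal (2 ^ Suc n / r) * indicator (ball a (r / 2 ^ n)) z)" for z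
  proof (cases "z \<in> ball a r \<and> z \<noteq> a")
    \<comment> \<open>At \<open>z = a\<close> the quotient is a division by zero and hence
      \<open>0\<close>, so the left side vanishes in both subcases.\<close>
    case False
    then show ?thesis by (auto simp: indicator_def)
  next
    case True
    define d where "d = norm (a - z)"
    have d: "0 < d" "d < r" using True by (auto simp: d_def dist_norm)
    have "\<exists>n. (1/2::real) ^ n < d / r"
      using d r by (intro real_arch_pow_inv) auto
    then obtain n0 where "(1/2::real) ^ n0 < d / r" ..
    then have ex: "\<exists>n. r / 2 ^ n \<le> d"
      using r by (intro exI[of _ n0]) (simp add: field_simps)
    \<comment> \<open>\<open>m\<close> is the first index whose radius has dropped to at most
      \<open>d\<close>. As \<open>d < r\<close> it is not \<open>0\<close>, so its predecessor
      \<open>n\<close> satisfies \<open>d < r / 2 ^ n\<close> and indexes the annulus containing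
      \<open>z\<close>.\<close>
    define m where "m = (LEAST n. r / 2 ^ n \<le> d)"
    have m: "r / 2 ^ m \<le> d" unfolding m_def by (rule LeastI_ex[OF ex])
    have "m \<noteq> 0" using m d by (intro notI) auto
    then obtain n where n: "m = Suc n" by (cases m) auto
    have "\<not> (r / 2 ^ n \<le> d)" using not_less_Least[of n "\<lambda>n. r / 2 ^ n \<le> d"] n m_def by auto
    then have zin: "z \<in> ball a (r / 2 ^ n)" by (simp add: d_def dist_norm)
    have "1 / d \<le> 2 ^ Suc n / r"
      using m n d r by (simp add: field_simps)
    define g where "g = (\<lambda>n. ennreal (2 ^ Suc n / r) * indicator (ball a (r / 2 ^ n)) z)"
    from \<open>1 / d \<le> 2 ^ Suc n / r\<close> have "ennreal (indicator (ball a r) z / norm (a - z)) \<le> g n"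
      using True zin by (simp add: d_def g_def indicator_def ennreal_leI)
    also have "g n \<le> (\<Sum>n. g n)"
      using sum_le_suminf[of g "{n}"] by (simp add: summableI)
    finally show ?thesis by (simp add: g_def)
  qed
  have [measurable]: "ball a s \<in> sets borel" for s by simp
  have "(\<integral>\<^sup>+z. ennreal (indicator (ball a r) z / norm (a - z)) \<partial>lborel)
      \<le> (\<integral>\<^sup>+z. (\<Sum>n. ennreal (2 ^ Suc n / r) * indicator (ball a (r / 2 ^ n)) z) \<partial>lborel)"
    by (intro nn_integral_mono 1)
  also have "\<dots> = (\<Sum>n. \<integral>\<^sup>+z. ennreal (2 ^ Suc n / r) * indicator (ball a (r / 2 ^ n)) z \<partial>lborel)"
    by (intro nn_integral_suminf) measurable
  \<comment> \<open>The disc of index \<open>n\<close> has area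
    \<open>pi * r\<^sup>2 / 4 ^ n\<close> and weight \<open>2 ^ Suc n / r\<close>, a contribution of
    \<open>2 * pi * r / 2 ^ n\<close>.\<close>
  also have "\<dots> = (\<Sum>n. ennreal ((1/2) ^ n * (2 * pi * r)))"
  proof (rule suminf_cong)
    fix n
    have "emeasure lborel (ball a (r / 2 ^ n)) = ennreal (pi * (r / 2 ^ n)\<^sup>2)"
      using r by (simp add: emeasure_ball unit_ball_vol_numeral(1) unit_ball_vol_2)
    then show "(\<integral>\<^sup>+z. ennreal (2 ^ Suc n / r) * indicator (ball a (r / 2 ^ n)) z \<partial>lborel)
        = ennreal ((1/2) ^ n * (2 * pi * r))"
      using r by (subst nn_integral_cmult_indicator)
        (simp_all add: ennreal_mult[symmetric] power2_eq_square field_simps)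
  qed
  also have "\<dots> = ennreal (\<Sum>n. (1/2) ^ n * (2 * pi * r))"
    using r by (intro suminf_ennreal2) (auto intro!: summable_mult2 summable_geometric)
  also have "(\<Sum>n. (1/2) ^ n * (2 * pi * r)) = 4 * pi * r"
    by (subst suminf_mult2[symmetric]) (auto simp: suminf_geometric)
  finally show ?thesis .
qed

subsection \<open>Cauchy transforms of bounded densities\<close>

lemma
  fixes a :: complex
  assumes r: "r > 0"
  shows integrable_inverse_dist_ball:
      "integrable lborel (\<lambda>z. indicator (ball a r) z / norm (a - z))"
    and integral_inverse_dist_ball:
      "(LINT z|lborel. indicator (ball a r) z / norm (a - z)) \<le> 4 * pi * r"
proof -
  have [measurable]: "ball a r \<in> sets borel" by simp
  show int: "integrable lborel (\<lambda>z. indicator (ball a r) z / norm (a - z))"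
  proof (rule integrableI_nonneg)
    show "(\<integral>\<^sup>+z. ennreal (indicator (ball a r) z / norm (a - z)) \<partial>lborel) < \<infinity>"
      using nn_integral_inverse_dist_ball[OF r, of a] by (simp add: le_less_trans)
  qed auto
  have "ennreal (LINT z|lborel. indicator (ball a r) z / norm (a - z))
      = (\<integral>\<^sup>+z. ennreal (indicator (ball a r) z / norm (a - z)) \<partial>lborel)"
    by (rule nn_integral_eq_integral[symmetric, OF int]) auto
  also have "\<dots> \<le> ennreal (4 * pi * r)" by (rule nn_integral_inverse_dist_ball[OF r])
  finally show "(LINT z|lborel. indicator (ball a r) z / norm (a - z)) \<le> 4 * pi * r"
    using r by (simp add: ennreal_le_iff)
qed

text \<open>The customary factor \<open>1 / pi\<close> is omitted. The kernel takes the value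
  \<open>0\<close> at \<open>z = w\<close>, which affects only a null set.\<close>

definition cauchy_transform :: "(complex \<Rightarrow> complex) \<Rightarrow> complex \<Rightarrow> complex" where
  "cauchy_transform \<rho> w = (LINT z|lborel. \<rho> z / (w - z))"

text \<open>Writing \<open>1 / u\<close> as \<open>cnj u\<close> over the squared norm and keeping
  the denominator at least \<open>e\<^sup>2\<close> gives a kernel that is continuous on the whole
  plane, bounded by \<open>1 / e\<close>, and equal to \<open>1 / u\<close> once
  \<open>norm u\<close> is at least \<open>e\<close>.\<close>

definition truncated_inverse :: "real \<Rightarrow> complex \<Rightarrow> complex" where
  "truncated_inverse e u = cnj u / of_real ((max (norm u) e)\<^sup>2)"

lemma inverse_eq_cnj_over_norm2: "1 / (u::complex) = cnj u / of_real ((norm u)\<^sup>2)"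
  by (cases "u = 0") (auto simp: field_simps complex_norm_square simp del: of_real_power)

text \<open>Outside the ball the two kernels agree. Inside, they differ by \<open>cnj u\<close>
  times a factor between \<open>0\<close> and \<open>1 / (norm u)\<^sup>2\<close>, which leaves at
  most \<open>1 / norm u\<close>. At \<open>u = 0\<close> both are \<open>0\<close>.\<close>

lemma truncated_inverse_diff:
  assumes "e > 0"
  shows "norm (1 / (w - z) - truncated_inverse e (w - z)) \<le> indicator (ball w e) z / norm (w - z)"
proof -
  define u where "u = w - z"
  have "norm (1 / u - truncated_inverse e u) \<le> (if norm u < e then 1 / norm u else 0)"
  proof (cases "norm u < e \<and> u \<noteq> 0")
    case True
    then have "1 / u - truncated_inverse e u = cnj u * of_real (1 / (norm u)\<^sup>2 - 1 / e\<^sup>2)"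
      unfolding inverse_eq_cnj_over_norm2 truncated_inverse_def by (simp add: algebra_simps max_def)
    then have "norm (1 / u - truncated_inverse e u) = norm u * \<bar>1 / (norm u)\<^sup>2 - 1 / e\<^sup>2\<bar>"
      by (metis complex_mod_cnj norm_mult norm_of_real)
    also have "\<bar>1 / (norm u)\<^sup>2 - 1 / e\<^sup>2\<bar> \<le> 1 / (norm u)\<^sup>2"
    proof -
      have "1 / e\<^sup>2 \<le> 1 / (norm u)\<^sup>2"
        using True by (intro divide_left_mono power_mono mult_pos_pos) auto
      moreover have "0 \<le> 1 / e\<^sup>2" by simp
      ultimately show ?thesis by linarith
    qed
    then have "norm u * \<bar>1 / (norm u)\<^sup>2 - 1 / e\<^sup>2\<bar> \<le> norm u * (1 / (norm u)\<^sup>2)"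
      by (intro mult_left_mono) auto
    also have "\<dots> = 1 / norm u" by (simp add: power2_eq_square)
    finally show ?thesis using True by simp
  next
    case False
    then consider "u = 0" | "e \<le> norm u" by fastforce
    then show ?thesis
    proof cases
      case 2
      then have "truncated_inverse e u = 1 / u"
        unfolding inverse_eq_cnj_over_norm2 truncated_inverse_def by (simp add: max_def)
      then show ?thesis by simp
    qed (simp add: truncated_inverse_def)
  qed
  then show ?thesis by (auto simp: u_def indicator_def dist_norm)
qed

lemma norm_truncated_inverse_le:
  assumes "e > 0"
  shows "norm (truncated_inverse e u) \<le> 1 / e"
proof -
  define m where "m = max (norm u) e"
  have m: "m > 0" "norm u \<le> m" "e \<le> m" using assms by (auto simp: m_def)
  have "norm (truncated_inverse e u) = norm u / m\<^sup>2"
    by (simp add: truncated_inverse_def m_def norm_divide norm_power)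
  also have "\<dots> \<le> m / m\<^sup>2" using m by (intro divide_right_mono) auto
  also have "\<dots> = 1 / m" using m by (simp add: power2_eq_square)
  also have "\<dots> \<le> 1 / e" using m assms by (simp add: frac_le)
  finally show ?thesis .
qed

lemma continuous_on_truncated_inverse:
  assumes "e > 0"
  shows "continuous_on UNIV (truncated_inverse e)"
  unfolding truncated_inverse_def using assms
  by (intro continuous_intros) (simp, metis less_max_iff_disj less_irrefl)

lemma emeasure_ball_finite: "emeasure lborel (ball (a::'a::euclidean_space) r) < top"
  using emeasure_bounded_finite[OF bounded_ball, of a r] by simp

locale bounded_density =
  fixes \<rho> :: "complex \<Rightarrow> complex" and M R :: real
  assumes measurable_density [measurable]: "\<rho> \<in> borel_measurable borel"
    and density_le: "norm (\<rho> z) \<le> M * indicator (ball 0 R) z"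
    and bounds_pos: "M > 0" "R > 0"
begin

text \<open>The factor \<open>g\<close> is controlled only where the density is nonzero, so that
  \<open>g\<close> may be a kernel with singularities off that set, such as a term of a geometric
  series or a derivative of the Cauchy kernel.\<close>

lemma integrable_density_mult:
  assumes [measurable]: "g \<in> borel_measurable borel"
    and g: "\<And>z. \<rho> z \<noteq> 0 \<Longrightarrow> norm (g z) \<le> c"
    and c: "0 \<le> c"
  shows "integrable lborel (\<lambda>z. \<rho> z * g z)"
    and "norm (LINT z|lborel. \<rho> z * g z) \<le> c * (M * measure lborel (ball (0::complex) R))"
proof -
  have b: "norm (\<rho> z * g z) \<le> c * M * indicator (ball 0 R) z" for z
  proof (cases "\<rho> z = 0")
    case True
    then show ?thesis using c bounds_pos by simp
  next
    case False
    have "norm (\<rho> z * g z) \<le> (M * indicator (ball 0 R) z) * c"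
      unfolding norm_mult using g[OF False] density_le[of z] bounds_pos
      by (intro mult_mono) (auto simp: indicator_def)
    then show ?thesis by (simp add: algebra_simps)
  qed
  have [measurable]: "ball (0::complex) R \<in> sets borel" by simp
  have i: "integrable lborel (\<lambda>z. c * M * indicator (ball (0::complex) R) z)"
    by (intro integrable_mult_right integrable_real_indicator) (auto simp: emeasure_ball_finite)
  show "integrable lborel (\<lambda>z. \<rho> z * g z)"
  proof (rule Bochner_Integration.integrable_bound[OF i])
    show "AE z in lborel. norm (\<rho> z * g z) \<le> norm (c * M * indicator (ball 0 R) z :: real)"
      using order_trans[OF b abs_ge_self] by simp
  qed simp
  show "norm (LINT z|lborel. \<rho> z * g z) \<le> c * (M * measure lborel (ball (0::complex) R))"
    using Bochner_Integration.integral_norm_bound_integral[OF \<open>integrable lborel (\<lambda>z. \<rho> z * g z)\<close> i b]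
    by (simp add: algebra_simps)
qed


lemma density_outside: "z \<notin> ball 0 R \<Longrightarrow> \<rho> z = 0"
  using density_le[of z] by simp

lemma norm_density_le: "norm (\<rho> z) \<le> M"
  using density_le[of z] bounds_pos by (cases "z \<in> ball 0 R") auto

lemma integrable_cauchy_kernel: "integrable lborel (\<lambda>z. \<rho> z / (w - z))"
proof (rule Bochner_Integration.integrable_bound)
  \<comment> \<open>The radius \<open>norm w + R\<close> makes the ball about \<open>w\<close>
    contain \<open>ball 0 R\<close>, off which the density is zero.\<close>
  show "integrable lborel (\<lambda>z. M * (indicator (ball w (norm w + R)) z / norm (w - z)))"
    using bounds_pos by (intro integrable_mult_right integrable_inverse_dist_ball) (simp add: add_nonneg_pos)
  have "norm (\<rho> z / (w - z)) \<le> norm (M * (indicator (ball w (norm w + R)) z / norm (w - z)))" for z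
  proof (cases "z \<in> ball 0 R")
    case True
    then have "z \<in> ball w (norm w + R)"
      using norm_triangle_ineq4[of w z] by (simp add: dist_norm)
    then show ?thesis
      using norm_density_le[of z] bounds_pos by (simp add: norm_divide divide_right_mono)
  next
    case False
    then show ?thesis by (simp add: density_outside)
  qed
  then show "AE z in lborel. norm (\<rho> z / (w - z))
      \<le> norm (M * (indicator (ball w (norm w + R)) z / norm (w - z)))" by simp
qed simp

lemma continuous_on_truncated_transform:
  assumes e: "e > 0"
  shows "continuous_on UNIV (\<lambda>w. LINT z|lborel. \<rho> z * truncated_inverse e (w - z))"
proof (rule continuous_at_imp_continuous_on, intro ballI continuous_at_sequentiallyI)
  fix u :: "nat \<Rightarrow> complex" and a assume u: "u \<longlonglongrightarrow> a"
  have [measurable]: "truncated_inverse e \<in> borel_measurable borel"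
    by (intro borel_measurable_continuous_onI continuous_on_truncated_inverse e)
  have [measurable]: "ball (0::complex) R \<in> sets borel" by simp
  show "(\<lambda>n. LINT z|lborel. \<rho> z * truncated_inverse e (u n - z))
      \<longlonglongrightarrow> (LINT z|lborel. \<rho> z * truncated_inverse e (a - z))"
  proof (rule integral_dominated_convergence)
    show "integrable lborel (\<lambda>z. M * indicator (ball (0::complex) R) z * (1 / e))"
      by (intro integrable_mult_right integrable_mult_left integrable_real_indicator)
        (auto simp: emeasure_ball_finite)
    show "AE z in lborel. norm (\<rho> z * truncated_inverse e (u n - z))
        \<le> M * indicator (ball (0::complex) R) z * (1 / e)" for n
      unfolding norm_mult using density_le norm_truncated_inverse_le[OF e] bounds_pos
      by (intro always_eventually allI mult_mono) auto
    show "AE z in lborel. (\<lambda>n. \<rho> z * truncated_inverse e (u n - z))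
        \<longlonglongrightarrow> \<rho> z * truncated_inverse e (a - z)"
    proof (intro always_eventually allI tendsto_mult tendsto_const)
      fix z
      have "isCont (truncated_inverse e) (a - z)"
        using continuous_on_truncated_inverse[OF e] by (simp add: continuous_on_eq_continuous_at)
      then show "(\<lambda>n. truncated_inverse e (u n - z)) \<longlonglongrightarrow> truncated_inverse e (a - z)"
        by (rule isCont_tendsto_compose) (intro tendsto_intros u)
    qed
  qed measurable
qed

text \<open>The bound does not depend on \<open>w\<close>. As \<open>e\<close> tends to
  \<open>0\<close>, the continuous truncated transforms therefore converge uniformly, and the Cauchy
  transform inherits continuity.\<close>

lemma truncated_transform_diff:
  assumes e: "e > 0"
  shows "norm (cauchy_transform \<rho> w - (LINT z|lborel. \<rho> z * truncated_inverse e (w - z))) \<le> 4 * pi * M * e"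
proof -
  have [measurable]: "truncated_inverse e \<in> borel_measurable borel"
    by (intro borel_measurable_continuous_onI continuous_on_truncated_inverse e)
  have i: "integrable lborel (\<lambda>z. \<rho> z * truncated_inverse e (w - z))"
    by (rule integrable_density_mult[where c = "1 / e"]) (use e norm_truncated_inverse_le in auto)
  have "cauchy_transform \<rho> w - (LINT z|lborel. \<rho> z * truncated_inverse e (w - z))
      = (LINT z|lborel. \<rho> z / (w - z) - \<rho> z * truncated_inverse e (w - z))"
    unfolding cauchy_transform_def
    by (rule Bochner_Integration.integral_diff[OF integrable_cauchy_kernel i, symmetric])
  also have "norm \<dots> \<le> (LINT z|lborel. M * (indicator (ball w e) z / norm (w - z)))"
  proof (rule Bochner_Integration.integral_norm_bound_integral)
    show "integrable lborel (\<lambda>z. \<rho> z / (w - z) - \<rho> z * truncated_inverse e (w - z))"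
      by (rule Bochner_Integration.integrable_diff[OF integrable_cauchy_kernel i])
    show "integrable lborel (\<lambda>z. M * (indicator (ball w e) z / norm (w - z)))"
      by (intro integrable_mult_right integrable_inverse_dist_ball e)
    fix z
    have "\<rho> z / (w - z) - \<rho> z * truncated_inverse e (w - z)
        = \<rho> z * (1 / (w - z) - truncated_inverse e (w - z))"
      by (simp add: algebra_simps)
    also have "norm \<dots> \<le> M * (indicator (ball w e) z / norm (w - z))"
      unfolding norm_mult using bounds_pos
      by (intro mult_mono norm_density_le truncated_inverse_diff e) auto
    finally show "norm (\<rho> z / (w - z) - \<rho> z * truncated_inverse e (w - z))
        \<le> M * (indicator (ball w e) z / norm (w - z))" .
  qed
  also have "\<dots> = M * (LINT z|lborel. indicator (ball w e) z / norm (w - z))"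
    by (rule Bochner_Integration.integral_mult_right_zero)
  also have "\<dots> \<le> M * (4 * pi * e)"
    using bounds_pos by (intro mult_left_mono integral_inverse_dist_ball e) auto
  finally show ?thesis by (simp add: algebra_simps)
qed

lemma continuous_on_cauchy_transform: "continuous_on UNIV (cauchy_transform \<rho>)"
proof (rule uniform_limit_theorem)
  let ?v = "\<lambda>n w. LINT z|lborel. \<rho> z * truncated_inverse (1 / real (Suc n)) (w - z)"
  show "\<forall>\<^sub>F n in sequentially. continuous_on UNIV (?v n)"
    by (intro always_eventually allI continuous_on_truncated_transform) simp
  show "uniform_limit UNIV ?v (cauchy_transform \<rho>) sequentially"
  proof (rule uniform_limitI)
    fix e :: real assume "e > 0"
    have "(\<lambda>n. 4 * pi * M * (1 / real (Suc n))) \<longlonglongrightarrow> 4 * pi * M * 0"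
      by (intro tendsto_intros LIMSEQ_Suc[OF lim_1_over_n])
    then have "\<forall>\<^sub>F n in sequentially. 4 * pi * M * (1 / real (Suc n)) < e"
      using \<open>e > 0\<close> by (intro order_tendstoD) auto
    then show "\<forall>\<^sub>F n in sequentially. \<forall>w\<in>UNIV. dist (?v n w) (cauchy_transform \<rho> w) < e"
    proof eventually_elim
      case (elim n)
      show ?case
        using truncated_transform_diff[of "1 / real (Suc n)"] elim
        by (auto simp: dist_norm norm_minus_commute intro: le_less_trans)
    qed
  qed
qed simp

text \<open>Differentiation under the integral sign: near a point of \<open>S\<close> the kernel
  stays away from its singularity wherever the density is nonzero, and the difference quotient
  converges with an explicit linear error.\<close>

lemma holomorphic_on_cauchy_transform:
  assumes S: "open S" and zero: "\<And>z. z \<in> S \<Longrightarrow> \<rho> z = 0"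
  shows "cauchy_transform \<rho> holomorphic_on S"
  unfolding holomorphic_on_open[OF S]
proof
  fix a assume "a \<in> S"
  then obtain r where r: "r > 0" "ball a r \<subseteq> S" using S by (auto elim: openE)
  \<comment> \<open>With half the radius, every \<open>w\<close> in \<open>ball a d\<close> keeps
    distance at least \<open>d\<close> from each point where the density is nonzero.\<close>
  define d where "d = r / 2"
  have d: "d > 0" using r by (simp add: d_def)
  define L where "L = M * measure lborel (ball (0::complex) R)"
  define D where "D = (LINT z|lborel. \<rho> z * (- 1 / (a - z)\<^sup>2))"
  have far: "d \<le> norm (w - z)" "w \<noteq> z" if "w \<in> ball a d" "\<rho> z \<noteq> 0" for w z
  proof -
    have "z \<notin> ball a r" using that zero r by auto
    then show "d \<le> norm (w - z)"
      using that dist_triangle[of a z w] by (simp add: d_def dist_norm)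
    then show "w \<noteq> z" using d by auto
  qed
  have a: "a \<in> ball a d" using d by simp
  have iD: "integrable lborel (\<lambda>z. \<rho> z * (- 1 / (a - z)\<^sup>2))"
  proof (rule integrable_density_mult[where c = "1 / d\<^sup>2"])
    fix z assume "\<rho> z \<noteq> 0"
    then show "norm (- 1 / (a - z)\<^sup>2) \<le> 1 / d\<^sup>2"
      using far[OF a, of z] d by (simp add: norm_divide norm_power power_mono frac_le)
  qed auto
  \<comment> \<open>The difference quotient of the kernel minus its derivative is exactly
    \<open>(w - a) / ((w - z) * (a - z)\<^sup>2)\<close>, whose three denominator factors each
    contribute one power of \<open>d\<close>. \<open>L\<close> bounds the total mass of the
    density.\<close>
  have bound: "norm ((cauchy_transform \<rho> w - cauchy_transform \<rho> a) / (w - a) - D) \<le> norm (w - a) * (L / d ^ 3)"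
    if w: "w \<in> ball a d" "w \<noteq> a" for w
  proof -
    have "(cauchy_transform \<rho> w - cauchy_transform \<rho> a) / (w - a) - D
        = (LINT z|lborel. (\<rho> z / (w - z) - \<rho> z / (a - z)) / (w - a) - \<rho> z * (- 1 / (a - z)\<^sup>2))"
      unfolding cauchy_transform_def D_def using integrable_cauchy_kernel iD
      by (subst Bochner_Integration.integral_diff) auto
    also have "\<dots> = (LINT z|lborel. \<rho> z * ((w - a) / ((w - z) * (a - z)\<^sup>2)))"
    proof (rule Bochner_Integration.integral_cong[OF refl])
      fix z
      show "(\<rho> z / (w - z) - \<rho> z / (a - z)) / (w - a) - \<rho> z * (- 1 / (a - z)\<^sup>2)
          = \<rho> z * ((w - a) / ((w - z) * (a - z)\<^sup>2))"
      proof (cases "\<rho> z = 0")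
        case False
        then have "w - z \<noteq> 0" "a - z \<noteq> 0" "w - a \<noteq> 0" using far[of w z] far[of a z] w a by auto
        then show ?thesis by (simp add: divide_simps) (simp add: power2_eq_square algebra_simps)
      qed simp
    qed
    also have "norm \<dots> \<le> norm (w - a) / d ^ 3 * L"
      unfolding L_def
    proof (rule integrable_density_mult(2))
      fix z assume z: "\<rho> z \<noteq> 0"
      have "d ^ 3 = d * d\<^sup>2" by (simp add: power3_eq_cube power2_eq_square)
      also have "d * d\<^sup>2 \<le> norm (w - z) * (norm (a - z))\<^sup>2"
        using far(1)[OF w(1) z] far(1)[OF a z] d by (intro mult_mono power_mono) auto
      finally show "norm ((w - a) / ((w - z) * (a - z)\<^sup>2)) \<le> norm (w - a) / d ^ 3"
        using d by (simp add: norm_divide norm_mult norm_power frac_le)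
    qed (use d in auto)
    finally show ?thesis by (simp add: algebra_simps)
  qed
  have "((\<lambda>w. (cauchy_transform \<rho> w - cauchy_transform \<rho> a) / (w - a)) \<longlongrightarrow> D) (at a)"
  proof (rule Lim_transform2)
    show "((\<lambda>w. D) \<longlongrightarrow> D) (at a)" by simp
    have "((\<lambda>w. norm (w - a) * (L / d ^ 3)) \<longlongrightarrow> norm (a - a) * (L / d ^ 3)) (at a)"
      by (intro tendsto_intros)
    then have lim: "((\<lambda>w. norm (w - a) * (L / d ^ 3)) \<longlongrightarrow> 0) (at a)" by simp
    have "\<forall>\<^sub>F w in at a. norm (D - (cauchy_transform \<rho> w - cauchy_transform \<rho> a) / (w - a))
        \<le> norm (w - a) * (L / d ^ 3)"
      unfolding eventually_at using bound d by (auto simp: dist_commute norm_minus_commute intro!: exI[of _ d])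
    then show "((\<lambda>w. D - (cauchy_transform \<rho> w - cauchy_transform \<rho> a) / (w - a)) \<longlongrightarrow> 0) (at a)"
      by (rule Lim_null_comparison[OF _ lim])
  qed
  then show "\<exists>f'. (cauchy_transform \<rho> has_field_derivative f') (at a)"
    unfolding has_field_derivative_iff by blast
qed

end

subsection \<open>Radial densities\<close>

lemma integral_lborel_rotate:
  fixes f :: "complex \<Rightarrow> complex"
  assumes [measurable]: "f \<in> borel_measurable borel" and u: "norm u = 1"
  shows "(LINT z|lborel. f (u * z)) = (LINT z|lborel. f z)"
proof -
  have "orthogonal_transformation (\<lambda>z. u * z)"
    using u by (simp add: orthogonal_transformation norm_mult linear_iff algebra_simps)
  then have "(LINT z|lborel. f z) = (LINT z|distr lborel borel (\<lambda>z. u * z). f z)"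
    by (simp add: distr_lborel_orthogonal_transformation)
  also have "\<dots> = (LINT z|lborel. f (u * z))"
    by (rule integral_distr) measurable
  finally show ?thesis by simp
qed

text \<open>Rotation by \<open>cis (pi / n)\<close>, an \<open>n\<close>-th root of
  \<open>-1\<close>, preserves the integral and at the same time reverses its sign.\<close>

lemma integral_homogeneous_eq_0:
  fixes f :: "complex \<Rightarrow> complex"
  assumes [measurable]: "f \<in> borel_measurable borel" and n: "n > 0"
    and f: "\<And>u z. norm u = 1 \<Longrightarrow> u ^ n = -1 \<Longrightarrow> f (u * z) = - f z"
  shows "(LINT z|lborel. f z) = 0"
proof -
  define u where "u = cis (pi / real n)"
  have "u ^ n = cis (real n * (pi / real n))" by (simp only: u_def Complex.DeMoivre)
  then have u: "norm u = 1" "u ^ n = -1" using n by (auto simp: u_def)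
  have "(LINT z|lborel. f z) = (LINT z|lborel. f (u * z))"
    using integral_lborel_rotate[OF assms(1) u(1)] by simp
  also have "\<dots> = - (LINT z|lborel. f z)" using f[OF u] by simp
  finally show ?thesis by simp
qed

lemma AE_lborel_norm_neq: "AE z in lborel. norm (z::complex) \<noteq> r"
proof -
  have "negligible (sphere (0::complex) r)" by (rule negligible_sphere)
  then have "sphere (0::complex) r \<in> null_sets lborel"
    by (simp add: negligible_iff_null_sets null_sets_completion_iff)
  then have "AE z in lborel. z \<notin> sphere (0::complex) r" by (rule AE_not_in)
  then show ?thesis by simp
qed

locale radial_density = bounded_density +
  assumes radial: "norm u = 1 \<Longrightarrow> \<rho> (u * z) = \<rho> z"
begin

text \<open>Here and in \<open>cauchy_transform_inside_hole\<close> the kernel is expanded as a geometric series in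
  \<open>z / w\<close> or \<open>w / z\<close>. Every nonconstant term integrates to zero by rotation, and the remainder vanishes
  in the limit.\<close>
lemma cauchy_transform_outside_support:
  assumes w: "w \<noteq> 0" and supp: "\<And>z. norm w \<le> norm z \<Longrightarrow> \<rho> z = 0"
  shows "cauchy_transform \<rho> w = (LINT z|lborel. \<rho> z) / w"
proof -
  \<comment> \<open>\<open>J n\<close> is the remainder after the first \<open>n\<close> terms of
    the geometric series, so that \<open>J 0\<close> is the transform itself.\<close>
  define J where "J n = (LINT z|lborel. \<rho> z * (z / w) ^ n / (w - z))" for n
  have le1: "norm (z / w) < 1" if "\<rho> z \<noteq> 0" for z
    using supp[of z] that w by (auto simp: norm_divide not_le[symmetric])
  have pow1: "norm ((z / w) ^ n) \<le> 1" if "\<rho> z \<noteq> 0" for z n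
    using le1[OF that] by (simp add: norm_power power_le_one)
  have norm_le: "norm (\<rho> z * (z / w) ^ n / (w - z)) \<le> norm (\<rho> z / (w - z))" for z n
  proof (cases "\<rho> z = 0")
    case False
    then have "norm (\<rho> z) * norm ((z / w) ^ n) \<le> norm (\<rho> z) * 1"
      by (intro mult_left_mono pow1) auto
    then show ?thesis unfolding norm_divide norm_mult by (intro divide_right_mono) auto
  qed simp
  have int: "integrable lborel (\<lambda>z. \<rho> z * (z / w) ^ n / (w - z))" for n
    by (rule Bochner_Integration.integrable_bound[OF integrable_cauchy_kernel[of w]]) (use norm_le in auto)
  have int': "integrable lborel (\<lambda>z. \<rho> z * ((z / w) ^ n / w))" for n
  proof (rule integrable_density_mult[where c = "1 / norm w"])
    fix z assume "\<rho> z \<noteq> 0"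
    then show "norm ((z / w) ^ n / w) \<le> 1 / norm w"
      unfolding norm_divide[of "(z / w) ^ n" w] by (intro divide_right_mono pow1) auto
  qed auto
  have step: "J n = (LINT z|lborel. \<rho> z * ((z / w) ^ n / w)) + J (Suc n)" for n
  proof -
    have "J n = (LINT z|lborel. \<rho> z * ((z / w) ^ n / w) + \<rho> z * (z / w) ^ Suc n / (w - z))"
      unfolding J_def
    proof (rule Bochner_Integration.integral_cong[OF refl])
      fix z
      show "\<rho> z * (z / w) ^ n / (w - z) = \<rho> z * ((z / w) ^ n / w) + \<rho> z * (z / w) ^ Suc n / (w - z)"
      proof (cases "\<rho> z = 0")
        case False
        then have "w - z \<noteq> 0" using supp[of w] by auto
        then have "1 / (w - z) = 1 / w + (z / w) / (w - z)" using w by (simp add: divide_simps)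
        then have "\<rho> z * (z / w) ^ n * (1 / (w - z)) = \<rho> z * (z / w) ^ n * (1 / w + (z / w) / (w - z))"
          by simp
        then show ?thesis by (simp add: ring_distribs mult_ac)
      qed simp
    qed
    then show ?thesis unfolding J_def by (simp only: Bochner_Integration.integral_add[OF int' int])
  qed
  have zero: "(LINT z|lborel. \<rho> z * ((z / w) ^ n / w)) = 0" if "n > 0" for n
  proof (rule integral_homogeneous_eq_0[OF _ that])
    fix u z :: complex assume u: "norm u = 1" "u ^ n = - 1"
    have "(u * z / w) ^ n / w = u ^ n * ((z / w) ^ n / w)"
      by (simp add: power_divide power_mult_distrib)
    also have "\<dots> = - ((z / w) ^ n / w)" unfolding u(2) by simp
    finally show "\<rho> (u * z) * ((u * z / w) ^ n / w) = - (\<rho> z * ((z / w) ^ n / w))"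
      by (simp only: radial[OF u(1)] mult_minus_right)
  qed measurable
  then have "J (Suc (Suc n)) = J (Suc n)" for n
    by (simp only: step[of "Suc n"] zero[OF zero_less_Suc] add_0)
  then have const: "J (Suc n) = J (Suc 0)" for n
    by (induction n) simp_all
  have "J \<longlonglongrightarrow> (LINT z::complex|lborel. 0 :: complex)"
    unfolding J_def
  proof (rule integral_dominated_convergence)
    show "integrable lborel (\<lambda>z. norm (\<rho> z / (w - z)))"
      by (intro integrable_norm integrable_cauchy_kernel)
    show "AE z in lborel. (\<lambda>n. \<rho> z * (z / w) ^ n / (w - z)) \<longlonglongrightarrow> 0"
    proof (intro always_eventually allI)
      fix z
      show "(\<lambda>n. \<rho> z * (z / w) ^ n / (w - z)) \<longlonglongrightarrow> 0"
      proof (cases "\<rho> z = 0")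
        case False
        then have "(\<lambda>n. \<rho> z / (w - z) * (z / w) ^ n) \<longlonglongrightarrow> \<rho> z / (w - z) * 0"
          by (intro tendsto_intros LIMSEQ_power_zero le1)
        then show ?thesis by simp
      qed simp
    qed
  qed (use norm_le in auto)
  then have "(\<lambda>n. J (Suc n)) \<longlonglongrightarrow> 0" by (simp add: LIMSEQ_Suc)
  moreover have "(\<lambda>n. J (Suc n)) \<longlonglongrightarrow> J (Suc 0)"
    by (rule Lim_transform_eventually[OF tendsto_const]) (intro always_eventually allI const[symmetric])
  \<comment> \<open>From index \<open>1\<close> on, the remainders are all equal and yet tend to
    \<open>0\<close>. Only the constant term of the expansion survives.\<close>
  ultimately have "J (Suc 0) = 0" by (rule LIMSEQ_unique[symmetric])
  then have "J 0 = (LINT z|lborel. \<rho> z) / w" using step[of 0] by simp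
  then show ?thesis by (simp add: J_def cauchy_transform_def)
qed

lemma cauchy_transform_inside_hole:
  assumes w: "w \<noteq> 0" and supp: "\<And>z. norm z \<le> norm w \<Longrightarrow> \<rho> z = 0"
  shows "cauchy_transform \<rho> w = 0"
proof -
  define J where "J n = (LINT z|lborel. \<rho> z * (w / z) ^ n / (w - z))" for n
  have far: "norm w < norm z" if "\<rho> z \<noteq> 0" for z
    using supp[of z] that by (auto simp: not_le[symmetric])
  have le1: "norm (w / z) < 1" if "\<rho> z \<noteq> 0" for z
    using far[OF that] w by (simp add: norm_divide divide_less_eq)
  have pow1: "norm ((w / z) ^ n) \<le> 1" if "\<rho> z \<noteq> 0" for z n
    using le1[OF that] by (simp add: norm_power power_le_one)
  have norm_le: "norm (\<rho> z * (w / z) ^ n / (w - z)) \<le> norm (\<rho> z / (w - z))" for z n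
  proof (cases "\<rho> z = 0")
    case False
    then have "norm (\<rho> z) * norm ((w / z) ^ n) \<le> norm (\<rho> z) * 1"
      by (intro mult_left_mono pow1) auto
    then show ?thesis unfolding norm_divide norm_mult by (intro divide_right_mono) auto
  qed simp
  have int: "integrable lborel (\<lambda>z. \<rho> z * (w / z) ^ n / (w - z))" for n
    by (rule Bochner_Integration.integrable_bound[OF integrable_cauchy_kernel[of w]]) (use norm_le in auto)
  have int': "integrable lborel (\<lambda>z. \<rho> z * (- ((w / z) ^ n / z)))" for n
  proof (rule integrable_density_mult[where c = "1 / norm w"])
    fix z assume z: "\<rho> z \<noteq> 0"
    have "norm ((w / z) ^ n) / norm z \<le> 1 / norm w"
      using pow1[OF z, of n] far[OF z] w by (intro frac_le) auto
    then show "norm (- ((w / z) ^ n / z)) \<le> 1 / norm w"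
      by (simp only: norm_minus_cancel norm_divide[of _ z])
  qed auto
  have step: "J n = (LINT z|lborel. \<rho> z * (- ((w / z) ^ n / z))) + J (Suc n)" for n
  proof -
    have "J n = (LINT z|lborel. \<rho> z * (- ((w / z) ^ n / z)) + \<rho> z * (w / z) ^ Suc n / (w - z))"
      unfolding J_def
    proof (rule Bochner_Integration.integral_cong[OF refl])
      fix z
      show "\<rho> z * (w / z) ^ n / (w - z) = \<rho> z * (- ((w / z) ^ n / z)) + \<rho> z * (w / z) ^ Suc n / (w - z)"
      proof (cases "\<rho> z = 0")
        case False
        then have "w - z \<noteq> 0" "z \<noteq> 0" using far[of z] w by auto
        then have "1 / (w - z) = - (1 / z) + (w / z) / (w - z)" using w by (simp add: divide_simps)
        then have "\<rho> z * (w / z) ^ n * (1 / (w - z)) = \<rho> z * (w / z) ^ n * (- (1 / z) + (w / z) / (w - z))"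
          by simp
        then show ?thesis by (simp add: ring_distribs mult_ac)
      qed simp
    qed
    then show ?thesis unfolding J_def by (simp only: Bochner_Integration.integral_add[OF int' int])
  qed
  \<comment> \<open>The term of index \<open>n\<close> is homogeneous of degree
    \<open>-(n + 1)\<close> in \<open>z\<close>. Hence the term of index \<open>0\<close> vanishes
    as well, and the whole transform is zero.\<close>
  have zero: "(LINT z|lborel. \<rho> z * (- ((w / z) ^ n / z))) = 0" for n
  proof (rule integral_homogeneous_eq_0[of _ "Suc n"])
    fix u z :: complex assume u: "norm u = 1" "u ^ Suc n = - 1"
    have "(w / (u * z)) ^ n / (u * z) = (w / z) ^ n / z / u ^ Suc n"
      by (simp add: power_divide power_mult_distrib)
    also have "\<dots> = - ((w / z) ^ n / z)" unfolding u(2) by simp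
    finally show "\<rho> (u * z) * (- ((w / (u * z)) ^ n / (u * z))) = - (\<rho> z * (- ((w / z) ^ n / z)))"
      by (simp only: radial[OF u(1)] minus_minus mult_minus_right)
  qed (simp_all, measurable)
  then have "J (Suc n) = J n" for n
    by (simp only: step[of n] zero add_0)
  then have const: "J n = J 0" for n
    by (induction n) simp_all
  have "J \<longlonglongrightarrow> (LINT z::complex|lborel. 0 :: complex)"
    unfolding J_def
  proof (rule integral_dominated_convergence)
    show "integrable lborel (\<lambda>z. norm (\<rho> z / (w - z)))"
      by (intro integrable_norm integrable_cauchy_kernel)
    show "AE z in lborel. (\<lambda>n. \<rho> z * (w / z) ^ n / (w - z)) \<longlonglongrightarrow> 0"
    proof (intro always_eventually allI)
      fix z
      show "(\<lambda>n. \<rho> z * (w / z) ^ n / (w - z)) \<longlonglongrightarrow> 0"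
      proof (cases "\<rho> z = 0")
        case False
        then have "(\<lambda>n. \<rho> z / (w - z) * (w / z) ^ n) \<longlonglongrightarrow> \<rho> z / (w - z) * 0"
          by (intro tendsto_intros LIMSEQ_power_zero le1)
        then show ?thesis by simp
      qed simp
    qed
  qed (use norm_le in auto)
  then have "J \<longlonglongrightarrow> 0" by simp
  moreover have "J \<longlonglongrightarrow> J 0"
    by (rule Lim_transform_eventually[OF tendsto_const]) (intro always_eventually allI const[symmetric])
  ultimately have "J 0 = 0" by (rule LIMSEQ_unique[symmetric])
  then show ?thesis by (simp add: J_def cauchy_transform_def)
qed

text \<open>The planar form of Newton's shell theorem: the mass within the circle through
  \<open>w\<close> acts as if concentrated at the origin, and the mass beyond it has no
  effect.\<close>

lemma cauchy_transform_radial: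
  assumes w: "w \<noteq> 0"
  shows "cauchy_transform \<rho> w = (LINT z|lborel. \<rho> z * indicator (ball 0 (norm w)) z) / w"
proof -
  define \<rho>1 where "\<rho>1 z = \<rho> z * indicator (ball 0 (norm w)) z" for z
  define \<rho>2 where "\<rho>2 z = \<rho> z * indicator (- cball 0 (norm w)) z" for z
  have [measurable]: "ball (0::complex) r \<in> sets borel" "- cball (0::complex) r \<in> sets borel" for r
    by auto
  have [measurable]: "\<rho>1 \<in> borel_measurable borel" "\<rho>2 \<in> borel_measurable borel"
    unfolding \<rho>1_def \<rho>2_def by measurable
  interpret r1: radial_density \<rho>1 M R
  proof
    show "norm (\<rho>1 z) \<le> M * indicator (ball 0 R) z" for z
      using density_le[of z] order_trans[OF norm_ge_zero density_le[of z]]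
      by (auto simp: \<rho>1_def split: split_indicator)
  qed (use bounds_pos radial in \<open>auto simp: \<rho>1_def norm_mult indicator_def\<close>)
  interpret r2: radial_density \<rho>2 M R
  proof
    show "norm (\<rho>2 z) \<le> M * indicator (ball 0 R) z" for z
      using density_le[of z] order_trans[OF norm_ge_zero density_le[of z]]
      by (auto simp: \<rho>2_def split: split_indicator)
  qed (use bounds_pos radial in \<open>auto simp: \<rho>2_def norm_mult indicator_def\<close>)
  have "cauchy_transform \<rho> w = (LINT z|lborel. \<rho>1 z / (w - z) + \<rho>2 z / (w - z))"
    unfolding cauchy_transform_def
  proof (rule integral_cong_AE)
    \<comment> \<open>The two pieces miss the circle of radius \<open>norm w\<close>, which is a
      null set.\<close>
    show "AE z in lborel. \<rho> z / (w - z) = \<rho>1 z / (w - z) + \<rho>2 z / (w - z)"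
      using AE_lborel_norm_neq[of "norm w"]
      by eventually_elim (auto simp: \<rho>1_def \<rho>2_def indicator_def)
  qed auto
  also have "\<dots> = cauchy_transform \<rho>1 w + cauchy_transform \<rho>2 w"
    unfolding cauchy_transform_def
    by (rule Bochner_Integration.integral_add[OF r1.integrable_cauchy_kernel r2.integrable_cauchy_kernel])
  also have "cauchy_transform \<rho>2 w = 0"
    by (rule r2.cauchy_transform_inside_hole[OF w]) (simp add: \<rho>2_def)
  also have "cauchy_transform \<rho>1 w = (LINT z|lborel. \<rho>1 z) / w"
    by (rule r1.cauchy_transform_outside_support[OF w]) (simp add: \<rho>1_def)
  finally show ?thesis by (simp add: \<rho>1_def)
qed

end

section \<open>Moments of discs\<close>

definition disc_moment :: "nat \<Rightarrow> real" where
  "disc_moment n = (LINT z|lborel. norm z ^ n * indicator (ball (0::complex) 1) z)"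

lemma disc_moment_scale:
  assumes s: "s > 0"
  shows "(LINT z|lborel. norm z ^ n * indicator (ball (0::complex) s) z) = s ^ (n + 2) * disc_moment n"
proof -
  let ?f = "\<lambda>z. norm z ^ n * indicator (ball (0::complex) s) z :: real"
  have [measurable]: "ball (0::complex) s \<in> sets borel" by simp
  \<comment> \<open>Scaling the plane by \<open>s\<close> has Jacobian \<open>s\<^sup>2\<close>,
    which accounts for the exponent \<open>n + 2\<close>.\<close>
  have "(LINT z|lborel. ?f z)
      = (LINT z|density (distr lborel borel (\<lambda>x. 0 + s *\<^sub>R x)) (\<lambda>_. ennreal (s\<^sup>2)). ?f z)"
    using lborel_affine[of s "0::complex"] s by simp
  also have "\<dots> = (LINT z|lborel. s\<^sup>2 * ?f (s *\<^sub>R z))"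
    by (subst integral_density) (auto simp: integral_distr)
  also have "\<dots> = (LINT z|lborel. s ^ (n + 2) * (norm z ^ n * indicator (ball (0::complex) 1) z))"
    using s by (intro Bochner_Integration.integral_cong)
      (auto simp: indicator_def power_mult_distrib power_add power2_eq_square)
  finally show ?thesis by (simp add: disc_moment_def)
qed

text \<open>A moment of this kind is the constant \<open>K\<close> in the boundary identity, by
  which the Riemann map argument divides. A zero moment would force the integrand to vanish almost
  everywhere, making the unit disc a null set.\<close>

lemma disc_moment_pos: "disc_moment n > 0"
proof -
  have [measurable]: "ball (0::complex) 1 \<in> sets borel" by simp
  have i1: "integrable lborel (\<lambda>z. indicator (ball (0::complex) 1) z :: real)"
    by (simp add: emeasure_ball_finite)
  have int: "integrable lborel (\<lambda>z. norm z ^ n * indicator (ball (0::complex) 1) z :: real)"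
    by (rule Bochner_Integration.integrable_bound[OF i1]) (auto simp: indicator_def power_le_one)
  have "disc_moment n \<noteq> 0"
  proof
    assume "disc_moment n = 0"
    then have "AE z in lborel. norm z ^ n * indicator (ball (0::complex) 1) z = (0::real)"
      using integral_nonneg_eq_0_iff_AE[OF int] by (simp add: disc_moment_def)
    then have "AE z in lborel. z \<notin> ball (0::complex) 1"
      using AE_lborel_norm_neq[of 0] by eventually_elim (auto simp: indicator_def)
    then have "emeasure lborel (ball (0::complex) 1) = 0"
      by (subst (asm) AE_iff_measurable[of "ball (0::complex) 1"]) auto
    then show False by (simp add: emeasure_ball unit_ball_vol_2)
  qed
  moreover have "disc_moment n \<ge> 0" unfolding disc_moment_def by (rule Bochner_Integration.integral_nonneg) auto
  ultimately show ?thesis by simp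
qed

subsection \<open>The boundary identity of a quadrature domain\<close>

text \<open>The differential of a holomorphic function acts on a direction \<open>v\<close> as
  multiplication by \<open>v\<close>. Each partial derivative therefore adds one complex derivative
  and one factor \<open>v\<close>.\<close>

lemma iter_partial_holomorphic:
  assumes V: "open V" and f: "f holomorphic_on V" and x: "x \<in> V"
  shows "iter_partial vs f x = prod_list vs * (deriv ^^ length vs) f x"
    and "iter_partial vs f differentiable (at x)"
proof -
  \<comment> \<open>Taking the formula as a premise lets this fact serve both the induction step for
    the formula and, afterwards, the differentiability claim.\<close>
  have der: "(iter_partial vs f has_field_derivative prod_list vs * (deriv ^^ Suc (length vs)) f x) (at x)"
    if "x \<in> V" "\<And>x. x \<in> V \<Longrightarrow> iter_partial vs f x = prod_list vs * (deriv ^^ length vs) f x" for vs x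
  proof (rule has_field_derivative_transform_within_open[OF _ V that(1)])
    have "((deriv ^^ length vs) f has_field_derivative deriv ((deriv ^^ length vs) f) x) (at x)"
      by (rule holomorphic_derivI[OF holomorphic_higher_deriv[OF f V] V that(1)])
    then show "((\<lambda>x. prod_list vs * (deriv ^^ length vs) f x) has_field_derivative
        prod_list vs * (deriv ^^ Suc (length vs)) f x) (at x)"
      using DERIV_cmult by fastforce
  qed (simp add: that(2))
  have eq: "iter_partial vs f x = prod_list vs * (deriv ^^ length vs) f x" if "x \<in> V" for vs x
    using that
  proof (induction vs arbitrary: x)
    case (Cons v vs)
    have "(\<lambda>h. prod_list vs * (deriv ^^ Suc (length vs)) f x * h)
        = frechet_derivative (iter_partial vs f) (at x)"
      using der[OF Cons.prems Cons.IH] unfolding has_field_derivative_def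
      by (rule frechet_derivative_at)
    then show ?case by (simp flip: \<open>_ = frechet_derivative _ _\<close>)
  qed simp
  then show "iter_partial vs f x = prod_list vs * (deriv ^^ length vs) f x" using x .
  show "iter_partial vs f differentiable (at x)"
    using der[OF x eq] unfolding differentiable_def has_field_derivative_def by blast
qed

text \<open>This admits the Cauchy kernels with pole outside \<open>closure \<Omega>\<close> as test
  functions in the quadrature identity.\<close>

lemma holomorphic_on_nhd_closure_imp_A_infinity:
  assumes \<Omega>: "open \<Omega>" and V: "open V" "closure \<Omega> \<subseteq> V" and f: "f holomorphic_on V"
  shows "f \<in> A_infinity \<Omega>"
proof -
  have sub: "\<Omega> \<subseteq> V" using V closure_subset by blast
  have "\<exists>g. continuous_on (closure \<Omega>) g \<and> (\<forall>x\<in>\<Omega>. g x = iter_partial vs f x)" for vs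
  proof (intro exI conjI)
    show "continuous_on (closure \<Omega>) (iter_partial vs f)"
      using iter_partial_holomorphic(2)[OF V(1) f] V(2)
      by (intro continuous_at_imp_continuous_on) (auto intro: differentiable_imp_continuous_within)
  qed simp
  then show ?thesis
    using iter_partial_holomorphic(2)[OF V(1) f] sub \<Omega> f
    by (auto simp: A_infinity_def smooth_up_to_boundary_def smooth_on_def
        intro: holomorphic_on_subset)
qed

text \<open>Along a direction in which the differential of the defining function is positive, that
  function becomes positive right after leaving \<open>w\<close>, and points where it is positive
  are exterior. Identities known outside \<open>closure \<Omega>\<close> thus extend by continuity
  to every frontier point; a slit in the domain would obstruct this.\<close>

lemma frontier_subset_closure_exterior:
  assumes \<Omega>: "open \<Omega>" and "smooth_boundary \<Omega>"
  shows "frontier \<Omega> \<subseteq> closure (- closure \<Omega>)"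
proof
  fix w assume w: "w \<in> frontier \<Omega>"
  then obtain U and r :: "complex \<Rightarrow> real" where U: "open U" "w \<in> U" "smooth_on U r"
    and nz: "\<forall>z\<in>U. frechet_derivative r (at z) \<noteq> (\<lambda>_. 0)"
    and eq: "\<Omega> \<inter> U = {z\<in>U. r z < 0}"
    using assms unfolding smooth_boundary_def by blast
  have diff: "r differentiable (at z)" if "z \<in> U" for z
    using U(3) that unfolding smooth_on_def by (metis empty_subsetI iter_partial.simps(1) list.set(1))
  define L where "L = frechet_derivative r (at w)"
  have L: "(r has_derivative L) (at w)"
    using diff[OF U(2)] unfolding L_def by (simp add: frechet_derivative_works)
  then have lin: "linear L" by (rule has_derivative_linear)
  have "\<exists>d. L d > 0"
  proof -
    have "L \<noteq> (\<lambda>_. 0)" using nz U(2) by (simp add: L_def)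
    then obtain d where "L d \<noteq> 0" by (auto simp: fun_eq_iff)
    moreover have "L (- d) = - L d" by (rule linear_neg[OF lin])
    ultimately have "L d > 0 \<or> L (- d) > 0" by linarith
    then show ?thesis by blast
  qed
  then obtain d where d: "L d > 0" ..
  have "w \<notin> \<Omega>" using w \<Omega> by (simp add: frontier_def interior_open)
  then have "w \<notin> {z \<in> U. r z < 0}" unfolding eq[symmetric] by blast
  then have rw: "r w \<ge> 0" using U(2) by simp
  have "((\<lambda>t. r (w + t *\<^sub>R d)) has_derivative (\<lambda>t. L (t *\<^sub>R d))) (at 0)"
  proof (rule has_derivative_compose[where g = r])
    show "((\<lambda>t. w + t *\<^sub>R d) has_derivative (\<lambda>t. t *\<^sub>R d)) (at 0)"
      by (auto intro!: derivative_eq_intros)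
    show "(r has_derivative L) (at (w + 0 *\<^sub>R d))" using L by simp
  qed
  moreover have "(\<lambda>t. L (t *\<^sub>R d)) = (*) (L d)"
    by (intro ext) (simp add: linear_scale[OF lin])
  ultimately have "DERIV (\<lambda>t. r (w + t *\<^sub>R d)) 0 :> L d"
    by (simp add: has_field_derivative_def)
  from DERIV_pos_inc_right[OF this d] obtain \<delta> where \<delta>: "\<delta> > 0"
    "\<And>h. 0 < h \<Longrightarrow> h < \<delta> \<Longrightarrow> r w < r (w + h *\<^sub>R d)" by auto
  \<comment> \<open>By continuity the defining function stays positive near \<open>y\<close>, so an
    entire neighbourhood of \<open>y\<close> avoids \<open>\<Omega>\<close>.\<close>
  have ext: "y \<in> - closure \<Omega>" if y: "y \<in> U" "r y > 0" for y
  proof -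
    have "isCont r y" using diff[OF y(1)] by (rule differentiable_imp_continuous_within)
    then have "\<forall>\<^sub>F z in nhds y. r z > 0"
      using y(2) by (intro order_tendstoD(1)[of r "r y"]) (auto simp: isCont_def tendsto_at_iff_tendsto_nhds)
    moreover have "\<forall>\<^sub>F z in nhds y. z \<in> U" using U(1) y(1) by (rule eventually_nhds_in_open)
    ultimately have "\<forall>\<^sub>F z in nhds y. z \<notin> \<Omega>"
      by eventually_elim (use eq in force)
    then obtain T where "open T" "y \<in> T" "\<forall>z\<in>T. z \<notin> \<Omega>" unfolding eventually_nhds by blast
    then show ?thesis by (metis Compl_iff disjoint_iff open_Int_closure_eq_empty)
  qed
  have tendsto: "((\<lambda>t. w + t *\<^sub>R d) \<longlongrightarrow> w + 0 *\<^sub>R d) (at_right 0)"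
    by (intro tendsto_intros)
  show "w \<in> closure (- closure \<Omega>)"
  proof (rule Lim_in_closed_set[OF closed_closure _ _ tendsto[simplified]])
    have "\<forall>\<^sub>F t in at_right 0. w + t *\<^sub>R d \<in> U"
      using tendsto U(1,2) by (intro topological_tendstoD) auto
    moreover have "\<forall>\<^sub>F t in at_right 0. t \<in> {0<..<\<delta>}"
      using \<delta>(1) by (rule eventually_at_right_real)
    ultimately show "\<forall>\<^sub>F t in at_right 0. w + t *\<^sub>R d \<in> closure (- closure \<Omega>)"
    proof eventually_elim
      case (elim t)
      then have "w + t *\<^sub>R d \<in> - closure \<Omega>" using \<delta>(2)[of t] rw by (intro ext) auto
      then show ?case using closure_subset by blast
    qed
  qed simp
qed

lemma power_norm_div_eq:
  fixes w :: complex
  assumes "w \<noteq> 0"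
  shows "of_real (norm w ^ (2 * p + 2)) / w = w ^ p * cnj w ^ (p + 1)"
proof -
  have "norm w ^ (2 * p + 2) = ((norm w)\<^sup>2) ^ (p + 1)"
    by (simp only: power_mult[symmetric]) (simp add: algebra_simps)
  then have "of_real (norm w ^ (2 * p + 2)) = (w * cnj w) ^ (p + 1)"
    by (simp only: of_real_power complex_norm_square[symmetric])
  then show ?thesis using assms by (simp add: power_mult_distrib)
qed

text \<open>Multiplication by \<open>w - z\<^sub>0\<close> clears the pole, so that the identity
  equates a function continuous on the whole plane with a constant and passes from the exterior to
  its closure.\<close>

lemma quadrature_domain_boundary_identity:
  assumes dom: "smooth_bounded_domain \<Omega>" and "0 \<in> \<Omega>"
    and quad: "one_point_quadrature_domain p \<Omega> z\<^sub>0"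
  obtains v K c where "continuous_on UNIV v" "v holomorphic_on \<Omega>" "K > (0::real)"
    "\<And>w. w \<in> frontier \<Omega> \<Longrightarrow> (w - z\<^sub>0) * (of_real K * w ^ p * cnj w ^ (p + 1) - v w) = c"
proof -
  have \<Omega>: "open \<Omega>" "bounded \<Omega>" "smooth_boundary \<Omega>"
    using dom by (auto simp: smooth_bounded_domain_def)
  have z0: "z\<^sub>0 \<in> \<Omega>" using quad by (simp add: one_point_quadrature_domain_def)
  obtain c where c: "\<And>f. f \<in> A_infinity \<Omega> \<Longrightarrow>
      (LINT z:\<Omega>|lborel. f z * of_real (cmod z ^ (2 * p))) = c * f z\<^sub>0"
    using quad unfolding one_point_quadrature_domain_def by blast
  have "bounded (closure \<Omega>)" using \<Omega>(2) by (rule bounded_closure)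
  then obtain R where R: "R > 0" "closure \<Omega> \<subseteq> ball 0 R"
    using bounded_subset_ballD by blast
  then have \<Omega>R: "\<Omega> \<subseteq> ball 0 R" using closure_subset by blast
  define d where "d A z = of_real (norm z ^ (2 * p)) * (indicator A z :: complex)" for A and z :: complex
  have density: "bounded_density (d A) (R ^ (2 * p)) R"
    if [measurable]: "A \<in> sets borel" and A: "A \<subseteq> ball 0 R" for A
  proof
    show "d A \<in> borel_measurable borel" unfolding d_def by measurable
    show "norm (d A z) \<le> R ^ (2 * p) * indicator (ball 0 R) z" for z
      using A by (auto simp: d_def norm_mult norm_power power_mono split: split_indicator)
  qed (use R in auto)
  have \<Omega>b: "\<Omega> \<in> sets borel" using \<Omega>(1) by simp
  have Eb: "ball 0 R - \<Omega> \<in> sets borel" using \<Omega>(1) by auto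
  interpret B: radial_density "d (ball 0 R)" "R ^ (2 * p)" R
    by (intro radial_density.intro radial_density_axioms.intro density)
      (auto simp: d_def norm_mult indicator_def)
  interpret O: bounded_density "d \<Omega>" "R ^ (2 * p)" R
    by (rule density[OF \<Omega>b \<Omega>R])
  interpret E: bounded_density "d (ball 0 R - \<Omega>)" "R ^ (2 * p)" R
    by (rule density[OF Eb]) auto
  define K where "K = disc_moment (2 * p)"
  define v where "v = cauchy_transform (d (ball 0 R - \<Omega>))"
  define F where "F w = (w - z\<^sub>0) * (of_real K * w ^ p * cnj w ^ (p + 1) - v w)" for w
  have disc: "cauchy_transform (d (ball 0 R)) w = of_real K * w ^ p * cnj w ^ (p + 1)"
    if w: "w \<noteq> 0" "w \<in> ball 0 R" for w
  proof -
    have "cauchy_transform (d (ball 0 R)) w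
        = (LINT z|lborel. d (ball 0 R) z * indicator (ball 0 (norm w)) z) / w"
      by (rule B.cauchy_transform_radial[OF w(1)])
    also have "(LINT z|lborel. d (ball 0 R) z * indicator (ball 0 (norm w)) z)
        = (LINT z|lborel. complex_of_real (cmod z ^ (2 * p) * indicator (ball 0 (norm w)) z))"
      using w by (intro Bochner_Integration.integral_cong) (auto simp: d_def indicator_def)
    also have "\<dots> = of_real (norm w ^ (2 * p + 2) * K)"
    proof -
      have "norm w > 0" using w(1) by simp
      from disc_moment_scale[OF this] show ?thesis by (simp only: integral_complex_of_real K_def)
    qed
    also have "\<dots> / w = of_real K * (of_real (norm w ^ (2 * p + 2)) / w)" by simp
    also have "of_real (norm w ^ (2 * p + 2)) / w = w ^ p * cnj w ^ (p + 1)"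
      by (rule power_norm_div_eq[OF w(1)])
    finally show ?thesis by (simp only: mult.assoc)
  qed
  have split: "cauchy_transform (d (ball 0 R)) w = cauchy_transform (d \<Omega>) w + v w" for w
  proof -
    have "cauchy_transform (d (ball 0 R)) w
        = (LINT z|lborel. d \<Omega> z / (w - z) + d (ball 0 R - \<Omega>) z / (w - z))"
      unfolding cauchy_transform_def using \<Omega>R
      by (intro Bochner_Integration.integral_cong) (auto simp: d_def indicator_def)
    then show ?thesis
      unfolding v_def cauchy_transform_def
      by (simp only: Bochner_Integration.integral_add[OF O.integrable_cauchy_kernel E.integrable_cauchy_kernel])
  qed
  have outside: "cauchy_transform (d \<Omega>) w = c / (w - z\<^sub>0)" if w: "w \<notin> closure \<Omega>" for w
  proof -
    have "(\<lambda>z. 1 / (w - z)) \<in> A_infinity \<Omega>"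
      using w by (intro holomorphic_on_nhd_closure_imp_A_infinity[OF \<Omega>(1), of "- {w}"])
        (auto intro!: holomorphic_intros)
    from c[OF this] show ?thesis
      by (simp add: cauchy_transform_def set_lebesgue_integral_def d_def scaleR_conv_of_real
          of_real_indicator mult_ac)
  qed
  have F_ext: "F w = c" if w: "w \<in> - closure \<Omega> \<inter> (ball 0 R - {0})" for w
  proof -
    have "w \<noteq> z\<^sub>0" using w z0 closure_subset by blast
    have "w \<noteq> 0" "w \<in> ball 0 R" "w \<notin> closure \<Omega>" using w by auto
    then have "of_real K * w ^ p * cnj w ^ (p + 1) = c / (w - z\<^sub>0) + v w"
      using disc split[of w] outside by metis
    then have "of_real K * w ^ p * cnj w ^ (p + 1) - v w = c / (w - z\<^sub>0)"
      by (simp only: add_diff_cancel_right')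
    then show ?thesis using \<open>w \<noteq> z\<^sub>0\<close> by (simp add: F_def)
  qed
  have contv: "continuous_on UNIV v"
    unfolding v_def by (rule E.continuous_on_cauchy_transform)
  then have "continuous_on UNIV F"
    unfolding F_def by (intro continuous_intros)
  then have "closed {w. F w = c}"
    by (intro closed_Collect_eq continuous_intros)
  then have F_clos: "F w = c" if "w \<in> closure (- closure \<Omega> \<inter> (ball 0 R - {0}))" for w
    using that F_ext closure_minimal[of "- closure \<Omega> \<inter> (ball 0 R - {0})" "{w. F w = c}"] by blast
  show ?thesis
  proof (rule that[OF contv])
    show "v holomorphic_on \<Omega>"
      unfolding v_def by (rule E.holomorphic_on_cauchy_transform[OF \<Omega>(1)]) (simp add: d_def)
    show "K > 0" unfolding K_def by (rule disc_moment_pos)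
    fix w assume w: "w \<in> frontier \<Omega>"
    have "w \<in> ball 0 R - {0}"
      using w R(2) \<open>0 \<in> \<Omega>\<close> \<Omega>(1) by (auto simp: frontier_def interior_open)
    moreover have "w \<in> closure (- closure \<Omega>)"
      using frontier_subset_closure_exterior[OF \<Omega>(1,3)] w by blast
    \<comment> \<open>The punctured disc is where the formula \<open>disc\<close> is available.
      Being an open set around \<open>w\<close>, it may be intersected with the exterior without
      losing \<open>w\<close> from the closure.\<close>
    moreover have "open (ball (0::complex) R - {0})" by auto
    ultimately have "w \<in> closure ((ball 0 R - {0}) \<inter> - closure \<Omega>)"
      using open_Int_closure_subset by blast
    then show "(w - z\<^sub>0) * (of_real K * w ^ p * cnj w ^ (p + 1) - v w) = c"
      using F_clos[of w] unfolding F_def by (simp only: Int_commute)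
  qed
qed

subsection \<open>Holomorphic functions near the unit circle\<close>

text \<open>The maximum principle is applied on a slightly smaller disc, so no boundary values of
  \<open>f\<close> are required.\<close>

lemma Re_nonpos_of_boundary:
  assumes f: "f holomorphic_on ball 0 1"
    and bd: "\<And>e::real. e > 0 \<Longrightarrow> \<exists>r<1. \<forall>t. r < norm t \<longrightarrow> norm t < 1 \<longrightarrow> Re (f t) < e"
    and t: "t \<in> ball 0 1"
  shows "Re (f t) \<le> 0"
proof (rule field_le_epsilon)
  fix e :: real assume "e > 0"
  then obtain r where r: "r < 1" "\<And>t. r < norm t \<Longrightarrow> norm t < 1 \<Longrightarrow> Re (f t) < e"
    using bd by blast
  have "max r (norm t) < 1" using r t by simp
  \<comment> \<open>The circle of radius \<open>s\<close> encloses \<open>t\<close> and lies in the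
    annulus where the real part is already below \<open>e\<close>.\<close>
  then obtain s where s: "max r (norm t) < s" "s < 1" using dense by blast
  then have "s > 0" using norm_ge_zero[of t] by linarith
  have "Re (f t) \<le> e"
  proof (rule maximum_real_frontier[of f "ball 0 s"])
    show "f holomorphic_on interior (ball 0 s)"
      using f by (rule holomorphic_on_subset) (use s in auto)
    show "continuous_on (closure (ball 0 s)) f"
      using holomorphic_on_imp_continuous_on[OF f] by (rule continuous_on_subset) (use s \<open>s > 0\<close> in auto)
    show "Re (f z) \<le> e" if "z \<in> frontier (ball 0 s)" for z
      using that \<open>s > 0\<close> s r(2)[of z] by (auto simp: frontier_ball less_imp_le)
  qed (use s in auto)
  then show "Re (f t) \<le> 0 + e" by simp
qed

text \<open>The maximum principle for \<open>f\<close> and \<open>- f\<close> puts the image inside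
  the imaginary axis, whereas a nonconstant \<open>f\<close> would have an open image.\<close>

lemma constant_if_Re_vanishes_at_boundary:
  assumes f: "f holomorphic_on ball 0 1"
    and bd: "\<And>e::real. e > 0 \<Longrightarrow> \<exists>r<1. \<forall>t. r < norm t \<longrightarrow> norm t < 1 \<longrightarrow> \<bar>Re (f t)\<bar> < e"
  shows "f constant_on ball 0 1"
proof (rule ccontr)
  assume "\<not> f constant_on ball 0 1"
  then have "open (f ` ball 0 1)" by (intro open_mapping_thm[OF f]) auto
  moreover have "f 0 \<in> f ` ball 0 1" by simp
  ultimately obtain e where e: "e > 0" "ball (f 0) e \<subseteq> f ` ball 0 1" by (meson openE)
  have Re0: "Re (f t) = 0" if t: "t \<in> ball 0 1" for t
  proof (rule antisym)
    show "Re (f t) \<le> 0"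
      by (rule Re_nonpos_of_boundary[OF f _ t]) (use bd in \<open>meson abs_less_iff\<close>)
    have "Re (- f t) \<le> 0"
      by (rule Re_nonpos_of_boundary[OF holomorphic_on_minus[OF f] _ t])
        (use bd in \<open>simp, meson abs_less_iff\<close>)
    then show "0 \<le> Re (f t)" by simp
  qed
  have "f 0 + of_real (e / 2) \<in> f ` ball 0 1"
    using e by (intro subsetD[OF e(2)]) (simp add: dist_norm)
  then have "Re (f 0 + of_real (e / 2)) = 0" using Re0 by (metis imageE)
  then show False using Re0[of 0] e by simp
qed

text \<open>The real part of \<open>cnj X - W\<close> is that of \<open>X - W\<close>, and its
  imaginary part is the real part of \<open>\<i> * (X + W)\<close>. Both of these holomorphic
  functions are therefore constant, and \<open>X\<close> is a linear combination of them.\<close>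

lemma constant_if_cnj_holomorphic_at_boundary:
  assumes X: "X holomorphic_on ball 0 1" and W: "W holomorphic_on ball 0 1"
    and bd: "\<And>e::real. e > 0 \<Longrightarrow> \<exists>r<1. \<forall>t. r < norm t \<longrightarrow> norm t < 1 \<longrightarrow> norm (cnj (X t) - W t) < e"
  shows "X constant_on ball 0 1"
proof -
  have "(\<lambda>t. X t - W t) constant_on ball 0 1"
  proof (rule constant_if_Re_vanishes_at_boundary)
    fix e :: real assume "e > 0"
    have "\<bar>Re (X t - W t)\<bar> \<le> norm (cnj (X t) - W t)" for t
      using abs_Re_le_cmod[of "cnj (X t) - W t"] by simp
    then show "\<exists>r<1. \<forall>t. r < norm t \<longrightarrow> norm t < 1 \<longrightarrow> \<bar>Re (X t - W t)\<bar> < e"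
      using bd[OF \<open>e > 0\<close>] by (meson le_less_trans)
  qed (intro holomorphic_intros X W)
  then obtain a where a: "\<And>t. t \<in> ball 0 1 \<Longrightarrow> X t - W t = a" unfolding constant_on_def by blast
  have "(\<lambda>t. \<i> * (X t + W t)) constant_on ball 0 1"
  proof (rule constant_if_Re_vanishes_at_boundary)
    fix e :: real assume "e > 0"
    have "\<bar>Re (\<i> * (X t + W t))\<bar> \<le> norm (cnj (X t) - W t)" for t
      using abs_Im_le_cmod[of "cnj (X t) - W t"] by simp
    then show "\<exists>r<1. \<forall>t. r < norm t \<longrightarrow> norm t < 1 \<longrightarrow> \<bar>Re (\<i> * (X t + W t))\<bar> < e"
      using bd[OF \<open>e > 0\<close>] by (meson le_less_trans)
  qed (intro holomorphic_intros X W)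
  then obtain b where b: "\<And>t. t \<in> ball 0 1 \<Longrightarrow> \<i> * (X t + W t) = b" unfolding constant_on_def by blast
  have "X t = (a - \<i> * b) / 2" if "t \<in> ball 0 1" for t
  proof -
    have "a - \<i> * b = 2 * X t" unfolding a[OF that, symmetric] b[OF that, symmetric]
      by (simp add: algebra_simps)
    then show ?thesis by simp
  qed
  then show ?thesis unfolding constant_on_def by blast
qed

section \<open>The normalised Riemann map and its behaviour near the unit circle\<close>

lemma riemann_map_with_center:
  assumes "open S" "simply_connected S" "a \<in> S" "S \<noteq> UNIV"
  obtains f g where "f holomorphic_on S" "g holomorphic_on ball 0 1"
    "\<And>z. z \<in> S \<Longrightarrow> f z \<in> ball 0 1 \<and> g (f z) = z"
    "\<And>t. t \<in> ball 0 1 \<Longrightarrow> g t \<in> S \<and> f (g t) = t"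
    "g 0 = a"
proof -
  obtain f g where f: "f holomorphic_on S" and g: "g holomorphic_on ball 0 1"
    and fg: "\<forall>z\<in>S. f z \<in> ball 0 1 \<and> g (f z) = z"
    and gf: "\<forall>t\<in>ball 0 1. g t \<in> S \<and> f (g t) = t"
    using assms simply_connected_eq_biholomorphic_to_disc[of S] by blast
  have "f a \<in> ball 0 1" using fg assms(3) by blast
  \<comment> \<open>A disc automorphism carries the image of \<open>a\<close> to the origin, which
    normalises the map.\<close>
  from ball_biholomorphism_exists[OF this] obtain m n where m: "m (f a) = 0"
    "m holomorphic_on ball 0 1" "m ` ball 0 1 \<subseteq> ball 0 1"
    and n: "n holomorphic_on ball 0 1" "n ` ball 0 1 \<subseteq> ball 0 1"
    and mn: "\<And>z. z \<in> ball 0 1 \<Longrightarrow> m (n z) = z" and nm: "\<And>z. z \<in> ball 0 1 \<Longrightarrow> n (m z) = z"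
    by blast
  show ?thesis
  proof (rule that[of "m \<circ> f" "g \<circ> n"])
    show "m \<circ> f holomorphic_on S"
      using fg m by (intro holomorphic_on_compose_gen[OF f m(2)]) auto
    show "g \<circ> n holomorphic_on ball 0 1"
      by (rule holomorphic_on_compose_gen[OF n(1) g n(2)])
    show "(m \<circ> f) z \<in> ball 0 1 \<and> (g \<circ> n) ((m \<circ> f) z) = z" if "z \<in> S" for z
      using that fg m(3) nm by (simp add: image_subset_iff)
    show "(g \<circ> n) t \<in> S \<and> (m \<circ> f) ((g \<circ> n) t) = t" if "t \<in> ball 0 1" for t
      using that gf n mn by (auto simp: image_subset_iff)
    have "n 0 = f a" using nm[OF \<open>f a \<in> ball 0 1\<close>] m(1) by simp
    then show "(g \<circ> n) 0 = a" using fg assms(3) by simp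
  qed
qed

text \<open>The filter expresses that \<open>norm t\<close> tends to \<open>1\<close> from below,
  uniformly in the argument of \<open>t\<close>; no individual point of the circle is singled
  out.\<close>

definition boundary_approach :: "complex filter" where
  "boundary_approach = filtercomap norm (at_left 1)"

lemma eventually_boundary_approach:
  "eventually P boundary_approach \<longleftrightarrow> (\<exists>r<1. \<forall>t. r < norm t \<longrightarrow> norm t < 1 \<longrightarrow> P t)"
proof
  assume "eventually P boundary_approach"
  then obtain Q where Q: "eventually Q (at_left 1)" "\<And>t. Q (norm t) \<Longrightarrow> P t"
    unfolding boundary_approach_def eventually_filtercomap by blast
  then obtain r where "r < 1" "\<And>y. r < y \<Longrightarrow> y < 1 \<Longrightarrow> Q y"
    unfolding eventually_at_left_field by blast
  then show "\<exists>r<1. \<forall>t. r < norm t \<longrightarrow> norm t < 1 \<longrightarrow> P t" using Q(2) by blast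
next
  assume "\<exists>r<1. \<forall>t. r < norm t \<longrightarrow> norm t < 1 \<longrightarrow> P t"
  then obtain r where r: "r < 1" "\<And>t. r < norm t \<Longrightarrow> norm t < 1 \<Longrightarrow> P t" by blast
  have "eventually (\<lambda>y. r < y \<and> y < 1) (at_left 1)"
    using r(1) unfolding eventually_at_left_field by blast
  then show "eventually P boundary_approach"
    unfolding boundary_approach_def eventually_filtercomap using r(2) by blast
qed

lemma tendsto_norm_boundary_approach: "(norm \<longlongrightarrow> 1) boundary_approach"
proof -
  have "filterlim norm (at_left 1) boundary_approach"
    unfolding boundary_approach_def by (rule filterlim_filtercomap)
  then show ?thesis by (rule filterlim_mono) (simp_all add: at_within_le_nhds)
qed

lemma eventually_in_unit_disc: "\<forall>\<^sub>F t in boundary_approach. t \<in> ball 0 1"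
  unfolding eventually_boundary_approach by (rule exI[of _ 0]) simp

lemma eventually_not_in_compact:
  assumes f: "continuous_on S f" and fg: "\<And>t. t \<in> ball 0 1 \<Longrightarrow> g t \<in> S \<and> f (g t) = t"
    and fS: "\<And>z. z \<in> S \<Longrightarrow> f z \<in> ball 0 1"
    and C: "compact C" "C \<subseteq> S"
  shows "\<forall>\<^sub>F t in boundary_approach. g t \<notin> C"
proof -
  have "compact (f ` C)" using f C by (meson compact_continuous_image continuous_on_subset)
  moreover have "f ` C \<subseteq> ball 0 1" using fS C by blast
  ultimately obtain s where s: "s < 1" "\<And>t. t \<in> f ` C \<Longrightarrow> norm t \<le> s"
  proof (cases "C = {}")
    case False
    then obtain t0 where "t0 \<in> f ` C" "\<And>t. t \<in> f ` C \<Longrightarrow> norm t \<le> norm t0"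
      using \<open>compact (f ` C)\<close> continuous_attains_sup[of "f ` C" norm] by (auto intro: continuous_intros)
    then show ?thesis using that[of "norm t0"] \<open>f ` C \<subseteq> ball 0 1\<close> by auto
  qed (use that[of 0] in auto)
  have "g t \<notin> C" if t: "s < norm t" "norm t < 1" for t
  proof
    assume "g t \<in> C"
    then have "f (g t) \<in> f ` C" by (rule imageI)
    then have "t \<in> f ` C" using fg[of t] t by simp
    then show False using s(2) t by force
  qed
  then show ?thesis unfolding eventually_boundary_approach using s(1) by blast
qed

text \<open>Injectivity excludes zeros of the quotient twice: away from \<open>a\<close> directly,
  and at \<open>a\<close> because the derivative of an injective holomorphic function does not
  vanish.\<close>

lemma holomorphic_divide_linear_factor:
  assumes f: "f holomorphic_on S" and S: "open S" and inj: "inj_on f S" and a: "a \<in> S"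
  obtains q where "q holomorphic_on S" "\<And>t. t \<in> S \<Longrightarrow> f t - f a = (t - a) * q t"
    "\<And>t. t \<in> S \<Longrightarrow> q t \<noteq> 0"
proof
  let ?q = "\<lambda>t. if t = a then deriv f a else (f t - f a) / (t - a)"
  show "?q holomorphic_on S" by (rule pole_lemma[OF f]) (use a S in \<open>simp add: interior_open\<close>)
  show "f t - f a = (t - a) * ?q t" if "t \<in> S" for t by simp
  show "?q t \<noteq> 0" if "t \<in> S" for t
    using holomorphic_injective_imp_regular[OF f S inj a] inj a that by (auto dest: inj_onD)
qed

subsection \<open>The Riemann map\<close>

lemma conformal_map_from_boundary_identity:
  assumes \<Omega>: "open \<Omega>" "bounded \<Omega>" and "0 \<in> \<Omega>" and z0: "z\<^sub>0 \<in> \<Omega>" "z\<^sub>0 \<noteq> 0"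
    and \<psi>: "\<psi> holomorphic_on \<Omega>" and \<phi>: "\<phi> holomorphic_on ball 0 1"
    and \<psi>\<phi>: "\<And>z. z \<in> \<Omega> \<Longrightarrow> \<psi> z \<in> ball 0 1 \<and> \<phi> (\<psi> z) = z"
    and \<phi>\<psi>: "\<And>t. t \<in> ball 0 1 \<Longrightarrow> \<phi> t \<in> \<Omega> \<and> \<psi> (\<phi> t) = t"
    and \<phi>0: "\<phi> 0 = 0"
    and v: "continuous_on UNIV v" "v holomorphic_on \<Omega>" and K: "K > (0::real)"
    and bd: "\<And>w. w \<in> frontier \<Omega> \<Longrightarrow> (w - z\<^sub>0) * (of_real K * w ^ p * cnj w ^ (p + 1) - v w) = c"
  shows "\<exists>C \<zeta>\<^sub>0 h.
           \<zeta>\<^sub>0 \<in> ball 0 1 \<and> \<zeta>\<^sub>0 \<noteq> 0 \<and>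
           analytic_root_branch (p + 1) (\<lambda>t. 1 - t * cnj \<zeta>\<^sub>0) h (ball 0 1) \<and>
           conformal_map_onto (\<lambda>t. C * t / h t) (ball 0 1) \<Omega>"
proof -
  define \<zeta>\<^sub>0 where "\<zeta>\<^sub>0 = \<psi> z\<^sub>0"
  have \<zeta>: "\<zeta>\<^sub>0 \<in> ball 0 1" "\<phi> \<zeta>\<^sub>0 = z\<^sub>0" using \<psi>\<phi>[OF z0(1)] by (auto simp: \<zeta>\<^sub>0_def)
  then have \<zeta>nz: "\<zeta>\<^sub>0 \<noteq> 0" using \<phi>0 z0(2) by auto
  have inj: "inj_on \<phi> (ball 0 1)" using \<phi>\<psi> by (metis inj_onI)
  have bij: "bij_betw \<phi> (ball 0 1) \<Omega>"
    by (rule bij_betwI[where g = \<psi>]) (use \<phi>\<psi> \<psi>\<phi> in auto)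
  have contpsi: "continuous_on \<Omega> \<psi>" using \<psi> by (rule holomorphic_on_imp_continuous_on)
  obtain q0 where q0: "q0 holomorphic_on ball 0 1" "\<And>t. t \<in> ball 0 1 \<Longrightarrow> \<phi> t = t * q0 t"
    "\<And>t. t \<in> ball 0 1 \<Longrightarrow> q0 t \<noteq> 0"
    using holomorphic_divide_linear_factor[OF \<phi> open_ball inj, of 0] \<phi>0 by auto
  obtain q1 where q1: "q1 holomorphic_on ball 0 1"
    "\<And>t. t \<in> ball 0 1 \<Longrightarrow> \<phi> t - z\<^sub>0 = (t - \<zeta>\<^sub>0) * q1 t"
    "\<And>t. t \<in> ball 0 1 \<Longrightarrow> q1 t \<noteq> 0"
    using holomorphic_divide_linear_factor[OF \<phi> open_ball inj, of \<zeta>\<^sub>0] \<zeta> by auto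
  \<comment> \<open>Insert \<open>\<phi> t = t * q0 t\<close> and
    \<open>\<phi> t - z\<^sub>0 = (t - \<zeta>\<^sub>0) * q1 t\<close> into the boundary identity
    and divide by \<open>K * q1 t * q0 t ^ p\<close>. It then says formally that
    \<open>(t - \<zeta>\<^sub>0) * t ^ p * cnj (\<phi> t) ^ (p + 1)\<close> equals
    \<open>W t\<close>.\<close>
  define W where "W t = ((\<phi> t - z\<^sub>0) * v (\<phi> t) + c) / (of_real K * q1 t * q0 t ^ p)" for t
  \<comment> \<open>On the unit circle \<open>t * cnj t = 1\<close>, which turns the left side of
    that relation into the conjugate of \<open>X t\<close>.\<close>
  define X where "X t = (1 - cnj \<zeta>\<^sub>0 * t) * q0 t ^ (p + 1)" for t
  have "(v \<circ> \<phi>) holomorphic_on ball 0 1"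
    using \<phi>\<psi> by (intro holomorphic_on_compose_gen[OF \<phi> v(2)]) auto
  then have W: "W holomorphic_on ball 0 1"
    unfolding W_def using q0(1,3) q1(1,3) K \<phi> by (intro holomorphic_intros) (auto simp: o_def)
  have X: "X holomorphic_on ball 0 1" unfolding X_def using q0(1) by (intro holomorphic_intros)

  define F where "F w = (w - z\<^sub>0) * (of_real K * w ^ p * cnj w ^ (p + 1) - v w) - c" for w
  have contF: "continuous_on UNIV F" unfolding F_def using v(1) by (intro continuous_intros)
  have F_lim: "((\<lambda>t. F (\<phi> t)) \<longlongrightarrow> 0) boundary_approach"
  proof (rule tendstoI)
    fix e :: real assume "e > 0"
    \<comment> \<open>\<open>F\<close> vanishes on the frontier, so this compact set lies inside
      \<open>\<Omega>\<close>, and by properness \<open>\<phi> t\<close> eventually leaves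
      it.\<close>
    let ?C = "closure \<Omega> \<inter> {w. e \<le> norm (F w)}"
    have "closed {w. e \<le> norm (F w)}"
      by (intro closed_Collect_le continuous_intros contF)
    then have "compact ?C" using \<Omega>(2) by (intro compact_Int_closed) (auto simp: compact_closure)
    moreover have "?C \<subseteq> \<Omega>"
    proof
      fix w assume w: "w \<in> ?C"
      then have "w \<notin> frontier \<Omega>" using bd \<open>e > 0\<close> by (auto simp: F_def)
      then show "w \<in> \<Omega>" using w \<Omega>(1) by (auto simp: frontier_def interior_open)
    qed
    ultimately have "\<forall>\<^sub>F t in boundary_approach. \<phi> t \<notin> ?C"
      using \<psi>\<phi> by (intro eventually_not_in_compact[OF contpsi \<phi>\<psi>]) auto
    then show "\<forall>\<^sub>F t in boundary_approach. dist (F (\<phi> t)) 0 < e"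
      using eventually_in_unit_disc
    proof eventually_elim
      case (elim t)
      then have "\<phi> t \<in> closure \<Omega>" using \<phi>\<psi> closure_subset by blast
      then show ?case using elim by auto
    qed
  qed

  obtain \<delta> where \<delta>: "\<delta> > 0" "cball 0 \<delta> \<subseteq> \<Omega>" "cball z\<^sub>0 \<delta> \<subseteq> \<Omega>"
  proof -
    obtain d0 d1 where "d0 > 0" "cball 0 d0 \<subseteq> \<Omega>" "d1 > 0" "cball z\<^sub>0 d1 \<subseteq> \<Omega>"
      using \<Omega>(1) \<open>0 \<in> \<Omega>\<close> z0(1) by (meson open_contains_cball)
    then show ?thesis using that[of "min d0 d1"] by (auto simp: subset_iff)
  qed
  have far: "\<forall>\<^sub>F t in boundary_approach. \<delta> < norm (\<phi> t - a)" if "cball a \<delta> \<subseteq> \<Omega>" for a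
  proof -
    have "\<forall>\<^sub>F t in boundary_approach. \<phi> t \<notin> cball a \<delta>"
      using \<psi>\<phi> that by (intro eventually_not_in_compact[OF contpsi \<phi>\<psi>]) auto
    then show ?thesis by eventually_elim (simp add: dist_norm norm_minus_commute)
  qed
  \<comment> \<open>\<open>D\<close> is the error of the pulled-back identity inside the disc. It
    equals \<open>F (\<phi> t)\<close> divided by \<open>K * q1 t * q0 t ^ p\<close>, a denominator
    that stays bounded away from zero near the circle.\<close>
  define D where "D t = (t - \<zeta>\<^sub>0) * t ^ p * cnj (\<phi> t) ^ (p + 1) - W t" for t
  have "(D \<longlongrightarrow> 0) boundary_approach"
  proof (rule Lim_null_comparison)
    show "\<forall>\<^sub>F t in boundary_approach. norm (D t) \<le> norm (F (\<phi> t)) / (K * (\<delta> / 2) * \<delta> ^ p)"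
      using far[OF \<delta>(2)] far[OF \<delta>(3)] eventually_in_unit_disc
    proof eventually_elim
      case (elim t)
      have nz: "of_real K * q1 t * q0 t ^ p \<noteq> 0" using q0(3) q1(3) K elim by auto
      have "D t * (of_real K * q1 t * q0 t ^ p)
          = (t - \<zeta>\<^sub>0) * t ^ p * cnj (\<phi> t) ^ (p + 1) * (of_real K * q1 t * q0 t ^ p)
            - ((\<phi> t - z\<^sub>0) * v (\<phi> t) + c)"
        using nz by (simp add: D_def W_def left_diff_distrib)
      also have "(t - \<zeta>\<^sub>0) * t ^ p * cnj (\<phi> t) ^ (p + 1) * (of_real K * q1 t * q0 t ^ p)
          = ((t - \<zeta>\<^sub>0) * q1 t) * of_real K * (t * q0 t) ^ p * cnj (\<phi> t) ^ (p + 1)"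
        by (simp only: power_mult_distrib mult_ac)
      also have "\<dots> = (\<phi> t - z\<^sub>0) * of_real K * \<phi> t ^ p * cnj (\<phi> t) ^ (p + 1)"
        by (simp only: q0(2)[OF elim(3), symmetric] q1(2)[OF elim(3), symmetric])
      finally have "D t * (of_real K * q1 t * q0 t ^ p) = F (\<phi> t)"
        by (simp add: F_def algebra_simps)
      then have eq: "norm (D t) = norm (F (\<phi> t)) / (K * norm (q1 t) * norm (q0 t) ^ p)"
        using nz K by (auto simp: norm_mult norm_power field_simps simp flip: \<open>_ = F (\<phi> t)\<close>)
      \<comment> \<open>The lower bounds \<open>\<delta>\<close> for \<open>q0\<close> and
        \<open>\<delta> / 2\<close> for \<open>q1\<close> come from \<open>norm t < 1\<close> and
        \<open>norm (t - \<zeta>\<^sub>0) \<le> 2\<close>, since \<open>\<phi> t\<close> keeps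
        distance greater than \<open>\<delta>\<close> from \<open>0\<close> and from
        \<open>z\<^sub>0\<close>.\<close>
      have "norm (\<phi> t) \<le> 1 * norm (q0 t)"
        using elim by (simp only: q0(2)[OF elim(3)] norm_mult) (intro mult_right_mono, auto)
      then have a: "\<delta> \<le> norm (q0 t)" using elim by simp
      have "norm (t - \<zeta>\<^sub>0) \<le> 2" using norm_triangle_ineq4[of t \<zeta>\<^sub>0] elim \<zeta> by simp
      then have "norm (\<phi> t - z\<^sub>0) \<le> 2 * norm (q1 t)"
        by (simp only: q1(2)[OF elim(3)] norm_mult) (intro mult_right_mono, auto)
      then have b: "\<delta> / 2 \<le> norm (q1 t)" using elim by simp
      show ?case unfolding eq
        using a b K \<delta>(1) by (intro divide_left_mono mult_mono power_mono mult_pos_pos zero_less_power) auto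
    qed
    have "((\<lambda>t. norm (F (\<phi> t)) / (K * (\<delta> / 2) * \<delta> ^ p)) \<longlongrightarrow> 0 / (K * (\<delta> / 2) * \<delta> ^ p)) boundary_approach"
      using \<delta>(1) K by (intro tendsto_divide tendsto_norm_zero F_lim tendsto_const) auto
    then show "((\<lambda>t. norm (F (\<phi> t)) / (K * (\<delta> / 2) * \<delta> ^ p)) \<longlongrightarrow> 0) boundary_approach" by simp
  qed
  moreover
  obtain B where B: "B > 0" "\<And>w. w \<in> \<Omega> \<Longrightarrow> norm w \<le> B"
    using \<Omega>(2) bounded_pos by blast
  have "((\<lambda>t. cnj (X t) - W t - D t) \<longlongrightarrow> 0) boundary_approach"
  proof (rule Lim_null_comparison)
    \<comment> \<open>Keeping \<open>t\<close> away from the origin lets the bound \<open>B\<close>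
      on \<open>\<phi>\<close> pass to the bound \<open>2 * B\<close> on \<open>q0\<close>.\<close>
    have half: "\<forall>\<^sub>F t in boundary_approach. norm t > 1 / 2"
      by (rule order_tendstoD(1)[OF tendsto_norm_boundary_approach]) simp
    show "\<forall>\<^sub>F t in boundary_approach. norm (cnj (X t) - W t - D t)
        \<le> ((1 - ((norm t)\<^sup>2) ^ (p + 1)) + (1 - ((norm t)\<^sup>2) ^ p)) * (2 * B) ^ (p + 1)"
      using half eventually_in_unit_disc
    proof eventually_elim
      case (elim t)
      \<comment> \<open>\<open>y\<close> is \<open>t * cnj t\<close>, which would be
        \<open>1\<close> on the circle. The error made by treating it as \<open>1\<close> consists
        of multiples of \<open>1 - y ^ (p + 1)\<close> and \<open>1 - y ^ p\<close>, both tending to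
        \<open>0\<close>.\<close>
      define y where "y = (norm t)\<^sup>2"
      have y: "0 \<le> y" "y \<le> 1" using elim by (auto simp: y_def power_le_one)
      have ty: "t * cnj t = of_real y" by (simp only: y_def complex_norm_square)
      have "(t - \<zeta>\<^sub>0) * t ^ p * cnj (\<phi> t) ^ (p + 1)
          = ((t * cnj t) ^ p * (t * cnj t - \<zeta>\<^sub>0 * cnj t)) * cnj (q0 t) ^ (p + 1)"
        by (simp add: q0(2)[OF elim(2)] power_mult_distrib algebra_simps)
      then have "cnj (X t) - W t - D t
          = (1 - \<zeta>\<^sub>0 * cnj t) * cnj (q0 t) ^ (p + 1)
            - ((t * cnj t) ^ p * (t * cnj t - \<zeta>\<^sub>0 * cnj t)) * cnj (q0 t) ^ (p + 1)"
        by (simp add: X_def D_def)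
      also have "\<dots> = (of_real (1 - y ^ (p + 1)) - \<zeta>\<^sub>0 * cnj t * of_real (1 - y ^ p)) * cnj (q0 t) ^ (p + 1)"
        unfolding ty by (simp add: algebra_simps)
      also have "norm \<dots> \<le> ((1 - y ^ (p + 1)) + (1 - y ^ p)) * (2 * B) ^ (p + 1)"
        unfolding norm_mult[of _ "cnj (q0 t) ^ (p + 1)"]
      proof (rule mult_mono)
        have "norm (\<zeta>\<^sub>0 * cnj t) \<le> 1" using \<zeta>(1) elim by (simp add: norm_mult mult_le_one)
        then have "norm (\<zeta>\<^sub>0 * cnj t * of_real (1 - y ^ p)) \<le> 1 * (1 - y ^ p)"
          unfolding norm_mult[of _ "of_real _"] norm_of_real using y
          by (intro mult_mono) (auto simp: power_le_one)
        then have "norm (\<zeta>\<^sub>0 * cnj t * of_real (1 - y ^ p)) \<le> 1 - y ^ p"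
          by (simp only: mult_1)
        moreover have "norm (of_real (1 - y ^ (p + 1)) :: complex) \<le> 1 - y ^ (p + 1)"
          unfolding norm_of_real using power_le_one[OF y, of "p + 1"] by (simp only: abs_of_nonneg diff_ge_0_iff_ge order_refl)
        ultimately show "norm (of_real (1 - y ^ (p + 1)) - \<zeta>\<^sub>0 * cnj t * of_real (1 - y ^ p))
            \<le> (1 - y ^ (p + 1)) + (1 - y ^ p)"
          by (intro order_trans[OF norm_triangle_ineq4 add_mono])
        have "norm t * norm (q0 t) \<le> B"
          using B(2)[of "\<phi> t"] \<phi>\<psi>[OF elim(2)] by (simp add: q0(2)[OF elim(2)] norm_mult)
        moreover have "1 / 2 * norm (q0 t) \<le> norm t * norm (q0 t)"
          using elim by (intro mult_right_mono) auto
        ultimately have "norm (q0 t) \<le> 2 * B" by simp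
        then have "norm (q0 t) ^ (p + 1) \<le> (2 * B) ^ (p + 1)" by (intro power_mono) auto
        then show "norm (cnj (q0 t) ^ (p + 1)) \<le> (2 * B) ^ (p + 1)"
          by (simp only: norm_power complex_mod_cnj)
        show "0 \<le> (1 - y ^ (p + 1)) + (1 - y ^ p)"
          using power_le_one[OF y, of p] power_le_one[OF y, of "p + 1"] by linarith
      qed simp
      finally show ?case by (simp only: y_def)
    qed
    have "((\<lambda>t. ((1 - ((norm t)\<^sup>2) ^ (p + 1)) + (1 - ((norm t)\<^sup>2) ^ p)) * (2 * B) ^ (p + 1))
        \<longlongrightarrow> ((1 - (1\<^sup>2) ^ (p + 1)) + (1 - (1\<^sup>2) ^ p)) * (2 * B) ^ (p + 1)) boundary_approach"
      by (intro tendsto_intros tendsto_norm_boundary_approach)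
    then show "((\<lambda>t. ((1 - ((norm t)\<^sup>2) ^ (p + 1)) + (1 - ((norm t)\<^sup>2) ^ p)) * (2 * B) ^ (p + 1))
        \<longlongrightarrow> 0) boundary_approach" by simp
  qed
  ultimately have lim: "((\<lambda>t. cnj (X t) - W t) \<longlongrightarrow> 0) boundary_approach"
    using tendsto_add[of "\<lambda>t. cnj (X t) - W t - D t" 0 boundary_approach D 0] by simp
  have "X constant_on ball 0 1"
  proof (rule constant_if_cnj_holomorphic_at_boundary[OF X W])
    fix e :: real assume "e > 0"
    then show "\<exists>r<1. \<forall>t. r < norm t \<longrightarrow> norm t < 1 \<longrightarrow> norm (cnj (X t) - W t) < e"
      using tendstoD[OF lim] unfolding eventually_boundary_approach by simp
  qed
  then have "X t = X 0" if "t \<in> ball 0 1" for t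
    using that unfolding constant_on_def by force
  then have root: "(1 - t * cnj \<zeta>\<^sub>0) * q0 t ^ (p + 1) = q0 0 ^ (p + 1)" if "t \<in> ball 0 1" for t
    using that by (simp add: X_def mult.commute)
  \<comment> \<open>By \<open>root\<close>, this quotient is the branch with value \<open>1\<close>
    at the origin, and \<open>\<phi> t = t * q0 t\<close> takes the required form with
    \<open>C = q0 0\<close>, the derivative of \<open>\<phi>\<close> at \<open>0\<close>.\<close>
  let ?h = "\<lambda>t. q0 0 / q0 t"
  have "analytic_root_branch (p + 1) (\<lambda>t. 1 - t * cnj \<zeta>\<^sub>0) ?h (ball 0 1)"
    unfolding analytic_root_branch_def
  proof (intro conjI ballI)
    show "?h holomorphic_on ball 0 1" using q0(1,3) by (intro holomorphic_intros)
    fix t :: complex assume t: "t \<in> ball 0 1"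
    have "?h t ^ (p + 1) = q0 0 ^ (p + 1) / q0 t ^ (p + 1)" by (rule power_divide)
    also have "\<dots> = 1 - t * cnj \<zeta>\<^sub>0"
      unfolding root[OF t, symmetric] using q0(3)[OF t] by simp
    finally show "?h t ^ (p + 1) = 1 - t * cnj \<zeta>\<^sub>0" .
  qed
  moreover have "conformal_map_onto (\<lambda>t. q0 0 * t / ?h t) (ball 0 1) \<Omega>"
  proof -
    have eq: "\<phi> t = q0 0 * t / ?h t" if "t \<in> ball 0 1" for t
      using q0(2)[OF that] q0(3)[of 0] by simp
    then have "(\<lambda>t. q0 0 * t / ?h t) holomorphic_on ball 0 1"
      using \<phi> by (rule holomorphic_transform[rotated])
    moreover have "bij_betw (\<lambda>t. q0 0 * t / ?h t) (ball 0 1) \<Omega>"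
      using bij by (rule bij_betw_cong[THEN iffD1, rotated]) (rule eq)
    ultimately show ?thesis unfolding conformal_map_onto_def by blast
  qed
  ultimately show ?thesis using \<zeta>(1) \<zeta>nz by blast
qed

theorem theorem7:
  fixes p :: nat and \<Omega> :: "complex set" and z\<^sub>0 :: complex
  assumes "p \<ge> 1"
    and "smooth_bounded_domain \<Omega>"
    and "simply_connected \<Omega>"
    and "0 \<in> \<Omega>"
    and "one_point_quadrature_domain p \<Omega> z\<^sub>0"
    and "z\<^sub>0 \<noteq> 0"
  shows "\<exists>C \<zeta>\<^sub>0 h.
           \<zeta>\<^sub>0 \<in> ball 0 1 \<and> \<zeta>\<^sub>0 \<noteq> 0 \<and>
           analytic_root_branch (p + 1) (\<lambda>t. 1 - t * cnj \<zeta>\<^sub>0) h (ball 0 1) \<and>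
           conformal_map_onto (\<lambda>t. C * t / h t) (ball 0 1) \<Omega>"
proof -
  have \<Omega>: "open \<Omega>" "bounded \<Omega>" using assms(2) by (auto simp: smooth_bounded_domain_def)
  have "\<Omega> \<noteq> UNIV" using \<Omega>(2) not_bounded_UNIV by auto
  then obtain \<psi> \<phi> where maps: "\<psi> holomorphic_on \<Omega>" "\<phi> holomorphic_on ball 0 1"
    "\<And>z. z \<in> \<Omega> \<Longrightarrow> \<psi> z \<in> ball 0 1 \<and> \<phi> (\<psi> z) = z"
    "\<And>t. t \<in> ball 0 1 \<Longrightarrow> \<phi> t \<in> \<Omega> \<and> \<psi> (\<phi> t) = t"
    "\<phi> 0 = 0"
    using riemann_map_with_center[OF \<Omega>(1) assms(3,4)] by blast
  obtain v K c where v: "continuous_on UNIV v" "v holomorphic_on \<Omega>" "K > (0::real)"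
    "\<And>w. w \<in> frontier \<Omega> \<Longrightarrow> (w - z\<^sub>0) * (of_real K * w ^ p * cnj w ^ (p + 1) - v w) = c"
    using quadrature_domain_boundary_identity[OF assms(2,4,5)] by blast
  have "z\<^sub>0 \<in> \<Omega>" using assms(5) by (simp add: one_point_quadrature_domain_def)
  from conformal_map_from_boundary_identity[OF \<Omega> assms(4) this assms(6) maps v]
  show ?thesis .
qed

end
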